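(* Fix $0<\alpha\le 1$. Let $\mathcal G_{k,\alpha}$ denote the Erdős–Rényi random graph on $k$ vertices with edge probability $\alpha$. Then, with probability tending to $1$ as $k\to\infty$, the limit $\ell(\mathcal G_{k,\alpha})$ exists and $$\ell(\mathcal G_{k,\alpha})=\frac{1}{\lambda(\mathcal G_{k,\alpha})}.$$
   Context: $H$-percolation: fix a graph $H$. Start with $\mathcal G_0=\mathcal G_{n,p}$ (Erdős–Rényi graph on $n$ vertices, edge probability $p$). For $t\ge 1$, obtain $\mathcal G_t$ from $\mathcal G_{t-1}$ by adding every edge $e\notin\mathcal G_{t-1}$ such that $\mathcal G_{t-1}\cup\{e\}$ contains a copy of $H$ containing $e$. Let $\langle \mathcal G_{n,p}\rangle_H=\bigcup_{t\ge0}\mathcal G_t$. The critical threshold is $p_c(n,H)=\inf\{p>0:\ \mathbb P(\langle\mathcal G_{n,p}\rangle_H=K_n)\ge 1/2\}$, and $\ell(H)=-\lim_{n\to\infty}\frac{\log p_c(n,H)}{\log n}$. For a graph $H$ with $v_H$ vertices and $e_H$ edges, $\lambda(H)=\frac{e_H-2}{v_H-2}$. *)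

theory Defs
  imports Complex_Main
begin

text \<open>Graphs on the vertex set {0..<n}, represented by their edge sets
  (sets of 2-element subsets of {0..<n}).\<close>

definition all_edges :: "nat \<Rightarrow> nat set set" where
  "all_edges n = {e. \<exists>u v. u < n \<and> v < n \<and> u \<noteq> v \<and> e = {u, v}}"

definition gnp_prob :: "nat \<Rightarrow> real \<Rightarrow> (nat set set \<Rightarrow> bool) \<Rightarrow> real" where
  "gnp_prob n p P = (\<Sum>G\<in>{G. G \<subseteq> all_edges n \<and> P G}.
      p ^ card G * (1 - p) ^ (card (all_edges n) - card G))"

definition has_copy_containing ::
  "nat \<Rightarrow> nat \<Rightarrow> nat set set \<Rightarrow> nat set set \<Rightarrow> nat set \<Rightarrow> bool" where
  "has_copy_containing n k EH G e \<longleftrightarrow>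
     (\<exists>f. inj_on f {0..<k} \<and> f ` {0..<k} \<subseteq> {0..<n} \<and>
          (\<forall>x\<in>EH. f ` x \<in> G) \<and> e \<in> (\<lambda>x. f ` x) ` EH)"

definition perc_step :: "nat \<Rightarrow> nat \<Rightarrow> nat set set \<Rightarrow> nat set set \<Rightarrow> nat set set" where
  "perc_step n k EH G =
     G \<union> {e \<in> all_edges n. e \<notin> G \<and> has_copy_containing n k EH (G \<union> {e}) e}"

definition perc_closure :: "nat \<Rightarrow> nat \<Rightarrow> nat set set \<Rightarrow> nat set set \<Rightarrow> nat set set" where
  "perc_closure n k EH G = (\<Union>t. (perc_step n k EH ^^ t) G)"

definition p_crit :: "nat \<Rightarrow> nat \<Rightarrow> nat set set \<Rightarrow> real" where
  "p_crit n k EH = Inf {p. 0 < p \<and> p \<le> 1 \<and>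
      gnp_prob n p (\<lambda>G. perc_closure n k EH G = all_edges n) \<ge> 1 / 2}"

definition lambda_H :: "nat \<Rightarrow> nat set set \<Rightarrow> real" where
  "lambda_H k EH = (real (card EH) - 2) / (real k - 2)"

end

theory Submission
  imports Defs "HOL-Library.FuncSet" "HOL-Library.Disjoint_Sets" "HOL-Real_Asymp.Real_Asymp"
begin

text \<open>
  Write $\lambda$ for $\lambda(H)$. Call $H$ balanced if $\lambda \ge 1$ and every vertex set $F$ with
  $2 \le |F| < v_H$ spans at most $\lambda (|F| - 2) + 1$ edges. For balanced $H$ the exponent is $1/\lambda$:

  \<^item> Above the threshold, chain copies of $H$ in which consecutive copies share an edge that is absent
    from the initial graph. A chain of $L$ copies hanging on a root edge has $L (v_H - 2)$ new vertices and
    $\lambda L (v_H - 2) + 1$ edges, and infects its root. Balancedness makes all proper rooted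
    subgraphs sparse enough for a second moment argument; repeating it on disjoint
    vertex classes makes the failure probability smaller than any power of $n$.

  \<^item> Below the threshold, cover the graph by edge-disjoint clusters, vertex sets $S$ owning at least
    $\lambda (|S| - 2) + 1$ edges, starting with the single edges. Whenever a copy of $H$ minus an edge is
    spread over several clusters, balancedness implies that their union is again a cluster. Hence an
    infected edge lies in a small cluster, or else some cluster has a size in a bounded window of
    large sizes; both are unlikely by a union bound over sets of bounded size.

  A random graph of density $\alpha$ is balanced with high probability: small sets $F$ satisfy the condition
  trivially, and for the others it follows from lower bounds on degrees and codegrees.
\<close>

section \<open>Expectation over random subsets\<close>

text \<open>Attaching a copy to a chain adds \<open>k - 2\<close> vertices but only
  \<open>card EH - 2\<close> edges: one edge of the copy is the one it infects, another is supplied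
  by the rest of the chain. Hence the two subtractions in \<lambda>. The function \<lambda> (s - 2)
  + 1 is tuned to both bounds: it equals 1 on a single edge (s = 2), and H minus an edge has exactly
  \<lambda> (v_H - 2) + 1 edges, so it reproduces itself under chaining and under merging.

  The additive 1 is an excess edge that never disappears. Above the threshold each new vertex gains
  a factor n^(\<epsilon> \<lambda>), so a long chain pays for it. One second moment estimate yields
  only a small negative power of n, too weak for a union bound over about n^2 edges; hence the
  independent repetitions.

  Below the threshold, infection may involve unboundedly many vertices, out of reach of a union
  bound. A merge joins fewer than e_H clusters, so cluster sizes cannot jump over a window of
  bounded width.

  For random H, passing from H to F saves, per removed vertex, a number of edges growing with |F|,
  which must beat fluctuations of order k. This fails for small F, where counting all pairs
  suffices.\<close>

definition bernoulli_exp :: "real \<Rightarrow> 'a set \<Rightarrow> ('a set \<Rightarrow> real) \<Rightarrow> real" where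
  "bernoulli_exp p E f = (\<Sum>G\<in>Pow E. p ^ card G * (1 - p) ^ card (E - G) * f G)"

lemma bernoulli_exp_cong:
  "(\<And>G. G \<subseteq> E \<Longrightarrow> f G = g G) \<Longrightarrow> bernoulli_exp p E f = bernoulli_exp p E g"
  unfolding bernoulli_exp_def by (intro sum.cong) auto

lemma bernoulli_exp_mono:
  assumes "0 \<le> p" "p \<le> 1" "\<And>G. G \<subseteq> E \<Longrightarrow> f G \<le> g G"
  shows "bernoulli_exp p E f \<le> bernoulli_exp p E g"
  unfolding bernoulli_exp_def using assms by (intro sum_mono mult_left_mono) auto

lemma bernoulli_exp_nonneg:
  assumes "0 \<le> p" "p \<le> 1" "\<And>G. G \<subseteq> E \<Longrightarrow> 0 \<le> f G"
  shows "0 \<le> bernoulli_exp p E f"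
  unfolding bernoulli_exp_def using assms by (intro sum_nonneg mult_nonneg_nonneg) auto

text \<open>Events enter as \<open>of_bool\<close>, so this linearity is the form in which every
  union bound below is taken.\<close>

lemma bernoulli_exp_sum:
  "bernoulli_exp p E (\<lambda>G. \<Sum>i\<in>I. f i G) = (\<Sum>i\<in>I. bernoulli_exp p E (f i))"
  unfolding bernoulli_exp_def sum_distrib_left by (rule sum.swap)

lemma bernoulli_exp_add:
  "bernoulli_exp p E (\<lambda>G. f G + g G) = bernoulli_exp p E f + bernoulli_exp p E g"
  unfolding bernoulli_exp_def by (simp add: distrib_left sum.distrib)

lemma bernoulli_exp_cmult:
  "bernoulli_exp p E (\<lambda>G. c * f G) = c * bernoulli_exp p E f"
  unfolding bernoulli_exp_def by (simp add: sum_distrib_left mult_ac)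

text \<open>Independence of disjoint parts: the weight of \<open>G\<close> factorises into the
  weights of its traces on \<open>A\<close> and \<open>B\<close>, and subsets of
  \<open>A \<union> B\<close> correspond to pairs of traces.\<close>

lemma bernoulli_exp_disjoint_Un:
  assumes fin: "finite A" "finite B" and disj: "A \<inter> B = {}"
  shows "bernoulli_exp p (A \<union> B) (\<lambda>G. f (G \<inter> A) * g (G \<inter> B))
    = bernoulli_exp p A f * bernoulli_exp p B g"
proof -
  let ?wt = "\<lambda>E G. p ^ card G * (1 - p) ^ card (E - G)"
  have wt: "?wt (A \<union> B) G = ?wt A (G \<inter> A) * ?wt B (G \<inter> B)" if G: "G \<subseteq> A \<union> B" for G
  proof -
    have "card G = card (G \<inter> A) + card (G \<inter> B)"
    proof -
      have "G = (G \<inter> A) \<union> (G \<inter> B)" using G by blast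
      then show ?thesis
        using card_Un_disjoint[of "G \<inter> A" "G \<inter> B"] fin disj by (metis finite_Int inf.assoc
            inf.left_commute inf_bot_right)
    qed
    moreover have "card (A \<union> B - G) = card (A - G \<inter> A) + card (B - G \<inter> B)"
    proof -
      have "A \<union> B - G = (A - G \<inter> A) \<union> (B - G \<inter> B)" by blast
      moreover have "(A - G \<inter> A) \<inter> (B - G \<inter> B) = {}" using disj by blast
      ultimately show ?thesis using fin by (simp add: card_Un_disjoint)
    qed
    ultimately show ?thesis by (simp add: power_add mult_ac)
  qed
  have "bernoulli_exp p A f * bernoulli_exp p B g
      = (\<Sum>(X, Y)\<in>Pow A \<times> Pow B. (?wt A X * f X) * (?wt B Y * g Y))"
    unfolding bernoulli_exp_def by (simp add: sum_product sum.cartesian_product)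
  also have "\<dots> = (\<Sum>G\<in>Pow (A \<union> B). ?wt (A \<union> B) G * (f (G \<inter> A) * g (G \<inter> B)))"
  proof (rule sum.reindex_bij_witness[where i = "\<lambda>G. (G \<inter> A, G \<inter> B)" and j = "\<lambda>(X, Y). X \<union> Y"])
    fix Z assume Z: "Z \<in> Pow A \<times> Pow B"
    then obtain X Y where XY: "Z = (X, Y)" "X \<subseteq> A" "Y \<subseteq> B" by blast
    have eq: "(X \<union> Y) \<inter> A = X" "(X \<union> Y) \<inter> B = Y" using XY disj by blast+
    show "((case Z of (X, Y) \<Rightarrow> X \<union> Y) \<inter> A, (case Z of (X, Y) \<Rightarrow> X \<union> Y) \<inter> B) = Z"
      using XY eq by simp
    show "(case Z of (X, Y) \<Rightarrow> X \<union> Y) \<in> Pow (A \<union> B)" using XY by auto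
    have "X \<union> Y \<subseteq> A \<union> B" using XY by blast
    from wt[OF this] show "?wt (A \<union> B) (case Z of (X, Y) \<Rightarrow> X \<union> Y)
        * (f ((case Z of (X, Y) \<Rightarrow> X \<union> Y) \<inter> A) * g ((case Z of (X, Y) \<Rightarrow> X \<union> Y) \<inter> B))
      = (case Z of (X, Y) \<Rightarrow> (?wt A X * f X) * (?wt B Y * g Y))"
      unfolding XY(1) prod.case eq by (simp add: mult_ac)
  qed auto
  finally show ?thesis unfolding bernoulli_exp_def by simp
qed

lemma bernoulli_exp_one: "finite E \<Longrightarrow> bernoulli_exp p E (\<lambda>_. 1) = 1"
proof (induction E rule: finite_induct)
  case empty
  then show ?case by (simp add: bernoulli_exp_def)
next
  case (insert a E)
  have "bernoulli_exp p ({a} \<union> E) (\<lambda>G. (\<lambda>_. 1) (G \<inter> {a}) * (\<lambda>_. 1) (G \<inter> E))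
    = bernoulli_exp p {a} (\<lambda>_. 1) * bernoulli_exp p E (\<lambda>_. 1)"
    using insert by (intro bernoulli_exp_disjoint_Un) auto
  moreover have "bernoulli_exp p {a} (\<lambda>_. 1) = 1"
    by (simp add: bernoulli_exp_def Pow_insert)
  ultimately show ?case using insert by simp
qed

lemma bernoulli_exp_restrict:
  assumes "finite E" "A \<subseteq> E"
  shows "bernoulli_exp p E (\<lambda>G. f (G \<inter> A)) = bernoulli_exp p A f"
proof -
  have "bernoulli_exp p (A \<union> (E - A)) (\<lambda>G. f (G \<inter> A) * (\<lambda>_. 1) (G \<inter> (E - A)))
      = bernoulli_exp p A f * bernoulli_exp p (E - A) (\<lambda>_. 1)"
    using assms by (intro bernoulli_exp_disjoint_Un) (auto intro: finite_subset)
  moreover have "A \<union> (E - A) = E" using assms by blast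
  ultimately show ?thesis using assms by (simp add: bernoulli_exp_one)
qed

lemma bernoulli_exp_prod:
  assumes "finite I" "finite E" "\<And>i. i \<in> I \<Longrightarrow> B i \<subseteq> E" "disjoint_family_on B I"
  shows "bernoulli_exp p E (\<lambda>G. \<Prod>i\<in>I. f i (G \<inter> B i)) = (\<Prod>i\<in>I. bernoulli_exp p (B i) (f i))"
  using assms
proof (induction I rule: finite_induct)
  case empty
  then show ?case by (simp add: bernoulli_exp_one)
next
  case (insert a I)
  let ?U = "\<Union>i\<in>I. B i"
  have U: "?U \<subseteq> E" "B a \<subseteq> E" using insert by auto
  have disj: "B a \<inter> ?U = {}"
    using insert unfolding disjoint_family_on_def by auto
  \<comment> \<open>The splitting lemma wants a ground set that is exactly the union of two parts.
    The integrand is therefore written as a function of \<open>G \<inter> (B a \<union> ?U)\<close>,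
    which lets \<open>E\<close> shrink to that union; \<open>E\<close> is restored later to match
    the induction hypothesis.\<close>
  have "bernoulli_exp p E (\<lambda>G. \<Prod>i\<in>insert a I. f i (G \<inter> B i))
    = bernoulli_exp p E (\<lambda>G. (\<lambda>G. f a (G \<inter> B a) * (\<Prod>i\<in>I. f i (G \<inter> ?U \<inter> B i))) (G \<inter> (B a \<union> ?U)))"
  proof (rule bernoulli_exp_cong)
    fix G
    have "G \<inter> (B a \<union> ?U) \<inter> B a = G \<inter> B a" by blast
    moreover have "(\<Prod>i\<in>I. f i (G \<inter> (B a \<union> ?U) \<inter> ?U \<inter> B i)) = (\<Prod>i\<in>I. f i (G \<inter> B i))"
      by (intro prod.cong refl arg_cong2[where f = f]) blast
    ultimately show "(\<Prod>i\<in>insert a I. f i (G \<inter> B i)) =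
        (\<lambda>G. f a (G \<inter> B a) * (\<Prod>i\<in>I. f i (G \<inter> ?U \<inter> B i))) (G \<inter> (B a \<union> ?U))"
      using insert by simp
  qed
  also have "\<dots> = bernoulli_exp p (B a \<union> ?U) (\<lambda>G. f a (G \<inter> B a) * (\<Prod>i\<in>I. f i (G \<inter> ?U \<inter> B i)))"
    using insert U by (intro bernoulli_exp_restrict) auto
  also have "\<dots> = bernoulli_exp p (B a) (f a) * bernoulli_exp p ?U (\<lambda>G. \<Prod>i\<in>I. f i (G \<inter> B i))"
    using insert U disj finite_subset[of _ E]
    by (intro bernoulli_exp_disjoint_Un[where f = "f a" and g = "\<lambda>G. \<Prod>i\<in>I. f i (G \<inter> B i)"]) auto
  also have "bernoulli_exp p ?U (\<lambda>G. \<Prod>i\<in>I. f i (G \<inter> B i))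
      = bernoulli_exp p ?U (\<lambda>G. (\<Prod>i\<in>I. f i (G \<inter> ?U \<inter> B i)))"
    by (intro bernoulli_exp_cong prod.cong refl arg_cong2[where f = f]) blast
  also have "\<dots> = bernoulli_exp p E (\<lambda>G. (\<Prod>i\<in>I. f i (G \<inter> ?U \<inter> B i)))"
    using bernoulli_exp_restrict[of E ?U p "\<lambda>G. \<Prod>i\<in>I. f i (G \<inter> ?U \<inter> B i)"] insert U
    by (simp add: Int_assoc)
  also have "\<dots> = bernoulli_exp p E (\<lambda>G. \<Prod>i\<in>I. f i (G \<inter> B i))"
    by (intro bernoulli_exp_cong prod.cong refl arg_cong2[where f = f]) blast
  also have "\<dots> = (\<Prod>i\<in>I. bernoulli_exp p (B i) (f i))"
    using insert by (intro insert.IH) (auto simp: disjoint_family_on_def)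
  finally show ?case using insert by simp
qed

lemma bernoulli_exp_supset:
  assumes "finite E" "A \<subseteq> E"
  shows "bernoulli_exp p E (\<lambda>G. of_bool (A \<subseteq> G)) = p ^ card A"
proof -
  have "bernoulli_exp p E (\<lambda>G. of_bool (A \<subseteq> G)) = bernoulli_exp p E (\<lambda>G. (\<lambda>H. of_bool (A \<subseteq> H)) (G \<inter> A))"
    by (intro bernoulli_exp_cong) simp
  also have "\<dots> = bernoulli_exp p A (\<lambda>H. of_bool (A \<subseteq> H))"
    using assms by (rule bernoulli_exp_restrict)
  also have "\<dots> = (\<Sum>H\<in>Pow A. if H = A then p ^ card A else 0)"
    unfolding bernoulli_exp_def by (intro sum.cong) auto
  also have "\<dots> = p ^ card A"
    using finite_subset[OF assms(2,1)] by simp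
  finally show ?thesis .
qed

section \<open>Second moment method\<close>

text \<open>Chebyshev: if no \<open>T i\<close> is present, the count X vanishes and (X - \<mu>)^2
  equals \<mu>^2. As all \<open>T i\<close> have \<open>m\<close> elements, two of them occur
  jointly with probability p^(2m) (1/p)^overlap; p^(2m) cancels against \<mu>^2 and only the
  overlaps remain.\<close>

lemma bernoulli_second_moment:
  fixes T :: "'i \<Rightarrow> 'a set"
  assumes E: "finite E" and I: "finite I" "I \<noteq> {}" and p: "0 < p" "p \<le> 1"
    and T: "\<And>i. i \<in> I \<Longrightarrow> T i \<subseteq> E" "\<And>i. i \<in> I \<Longrightarrow> card (T i) = m"
  shows "bernoulli_exp p E (\<lambda>G. of_bool (\<forall>i\<in>I. \<not> T i \<subseteq> G))
    \<le> (\<Sum>i\<in>I. \<Sum>j\<in>I. (1 / p) ^ card (T i \<inter> T j)) / real (card I) ^ 2 - 1"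
proof -
  define X :: "'a set \<Rightarrow> real" where "X G = (\<Sum>i\<in>I. of_bool (T i \<subseteq> G))" for G
  define \<mu> where "\<mu> = real (card I) * p ^ m"
  have \<mu>: "\<mu> > 0" unfolding \<mu>_def using p I by (simp add: card_gt_0_iff)
  have EX: "bernoulli_exp p E X = \<mu>"
    unfolding X_def bernoulli_exp_sum \<mu>_def using T E by (simp add: bernoulli_exp_supset)
  have EX2: "bernoulli_exp p E (\<lambda>G. X G ^ 2)
      = p ^ (2 * m) * (\<Sum>i\<in>I. \<Sum>j\<in>I. (1 / p) ^ card (T i \<inter> T j))"
  proof -
    have "bernoulli_exp p E (\<lambda>G. X G ^ 2)
        = bernoulli_exp p E (\<lambda>G. \<Sum>i\<in>I. \<Sum>j\<in>I. of_bool (T i \<union> T j \<subseteq> G))"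
      unfolding X_def power2_eq_square sum_product
      by (intro bernoulli_exp_cong sum.cong refl) simp
    also have "\<dots> = (\<Sum>i\<in>I. \<Sum>j\<in>I. p ^ card (T i \<union> T j))"
      unfolding bernoulli_exp_sum using T E by (intro sum.cong refl bernoulli_exp_supset) auto
    also have "\<dots> = (\<Sum>i\<in>I. \<Sum>j\<in>I. p ^ (2 * m) * (1 / p) ^ card (T i \<inter> T j))"
    proof (intro sum.cong refl)
      fix i j assume ij: "i \<in> I" "j \<in> I"
      then have "card (T i) + card (T j) = card (T i \<union> T j) + card (T i \<inter> T j)"
        using T E finite_subset by (intro card_Un_Int) blast+
      then have "2 * m = card (T i \<union> T j) + card (T i \<inter> T j)" using T ij by simp
      then have "p ^ (2 * m) = p ^ card (T i \<union> T j) * p ^ card (T i \<inter> T j)"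
        by (simp add: power_add)
      then show "p ^ card (T i \<union> T j) = p ^ (2 * m) * (1 / p) ^ card (T i \<inter> T j)"
        using p by (simp add: power_divide)
    qed
    finally show ?thesis by (simp add: sum_distrib_left)
  qed
  have "\<mu>\<^sup>2 * bernoulli_exp p E (\<lambda>G. of_bool (\<forall>i\<in>I. \<not> T i \<subseteq> G))
      = bernoulli_exp p E (\<lambda>G. \<mu>\<^sup>2 * of_bool (\<forall>i\<in>I. \<not> T i \<subseteq> G))"
    by (simp add: bernoulli_exp_cmult)
  also have "\<dots> \<le> bernoulli_exp p E (\<lambda>G. X G ^ 2 + ((- 2 * \<mu>) * X G + \<mu>\<^sup>2 * 1))"
  proof (rule bernoulli_exp_mono)
    fix G
    have "X G = 0" if "\<forall>i\<in>I. \<not> T i \<subseteq> G"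
      unfolding X_def using that by simp
    moreover have "0 \<le> (X G - \<mu>)\<^sup>2" by simp
    ultimately show "\<mu>\<^sup>2 * of_bool (\<forall>i\<in>I. \<not> T i \<subseteq> G) \<le> X G ^ 2 + ((- 2 * \<mu>) * X G + \<mu>\<^sup>2 * 1)"
      by (auto simp: power2_diff algebra_simps)
  qed (use p in auto)
  also have "\<dots> = bernoulli_exp p E (\<lambda>G. X G ^ 2) - \<mu>\<^sup>2"
    unfolding bernoulli_exp_add bernoulli_exp_cmult EX bernoulli_exp_one[OF E]
    by (simp add: power2_eq_square)
  finally have "bernoulli_exp p E (\<lambda>G. of_bool (\<forall>i\<in>I. \<not> T i \<subseteq> G))
      \<le> (bernoulli_exp p E (\<lambda>G. X G ^ 2) - \<mu>\<^sup>2) / \<mu>\<^sup>2"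
    using \<mu> by (simp add: field_simps)
  also have "\<dots> = bernoulli_exp p E (\<lambda>G. X G ^ 2) / \<mu>\<^sup>2 - 1"
    using \<mu> by (simp add: diff_divide_distrib)
  also have "\<mu>\<^sup>2 = p ^ (2 * m) * real (card I) ^ 2"
    unfolding \<mu>_def by (simp add: power_mult_distrib power_mult[symmetric] mult.commute)
  finally show ?thesis unfolding EX2 using p by simp
qed

text \<open>The template has roots $R$, embedded by \<open>\<rho>\<close>, and further vertices $S$; each $x \in S$ is sent into its own
  class of $w$ vertices \<open>h x 0, \<dots>, h x (w - 1)\<close>. Two embeddings then share exactly the template
  edges inside $R \cup A$, where $A$ is the set on which they agree.\<close>

lemma rooted_embedding_second_moment:
  fixes h :: "'v \<Rightarrow> nat \<Rightarrow> 'u" and \<rho> :: "'v \<Rightarrow> 'u" and T :: "'v set set"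
  assumes fin: "finite S" "finite T" "finite E" and SR: "S \<inter> R = {}"
    and T: "\<And>t. t \<in> T \<Longrightarrow> t \<subseteq> R \<union> S" "\<And>t. t \<in> T \<Longrightarrow> \<not> t \<subseteq> R"
    and h: "inj_on (\<lambda>(x, a). h x a) (S \<times> {..<w})" "inj_on \<rho> R"
      "\<And>x a. x \<in> S \<Longrightarrow> a < w \<Longrightarrow> h x a \<notin> \<rho> ` R"
    and E: "\<And>i t. i \<in> S \<rightarrow>\<^sub>E {..<w} \<Longrightarrow> t \<in> T \<Longrightarrow> (\<lambda>x. if x \<in> S then h x (i x) else \<rho> x) ` t \<in> E"
    and p: "0 < p" "p \<le> 1" and w: "w > 0"
  shows "bernoulli_exp p E (\<lambda>G. of_bool (\<forall>i\<in>S \<rightarrow>\<^sub>E {..<w}. \<not> (\<forall>t\<in>T. (\<lambda>x. if x \<in> S then h x (i x) else \<rho> x) ` t \<in> G)))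
    \<le> (\<Sum>A\<in>Pow S - {{}}. (1 / real w) ^ card A * (1 / p) ^ card {t \<in> T. t \<subseteq> R \<union> A})"
proof -
  define \<phi> where "\<phi> i x = (if x \<in> S then h x (i x) else \<rho> x)" for i :: "'v \<Rightarrow> nat" and x
  define I where "I = (S \<rightarrow>\<^sub>E {..<w})"
  define e where "e A = card {t \<in> T. t \<subseteq> R \<union> A}" for A
  have I: "finite I" "card I = w ^ card S"
    unfolding I_def using fin by (auto simp: finite_PiE card_PiE)
  have Ine: "I \<noteq> {}" using I(2) w by auto
  have coord: "x = y" "x \<in> S \<Longrightarrow> i x = j x"
    if "\<phi> i x = \<phi> j y" "x \<in> R \<union> S" "y \<in> R \<union> S" "i \<in> I" "j \<in> I" for i j x y
  proof -
    have i: "x \<in> S \<Longrightarrow> i x < w" and j: "y \<in> S \<Longrightarrow> j y < w"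
      using that unfolding I_def by auto
    have inj: "\<And>x a y b. h x a = h y b \<Longrightarrow> x \<in> S \<Longrightarrow> y \<in> S \<Longrightarrow> a < w \<Longrightarrow> b < w \<Longrightarrow> x = y \<and> a = b"
      using h(1) unfolding inj_on_def by force
    have "x = y \<and> (x \<in> S \<longrightarrow> i x = j x)"
    proof (cases "x \<in> S"; cases "y \<in> S")
      assume xy: "x \<in> S" "y \<in> S"
      then have "h x (i x) = h y (j y)" using that(1) by (simp add: \<phi>_def)
      from inj[OF this xy i[OF xy(1)] j[OF xy(2)]] show ?thesis by auto
    next
      assume xy: "x \<in> S" "y \<notin> S"
      then have "h x (i x) = \<rho> y" "y \<in> R" using that(1,3) by (auto simp: \<phi>_def)
      then show ?thesis using h(3)[OF xy(1) i[OF xy(1)]] by simp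
    next
      assume xy: "x \<notin> S" "y \<in> S"
      then have "\<rho> x = h y (j y)" "x \<in> R" using that(1,2) by (auto simp: \<phi>_def)
      then show ?thesis using h(3)[OF xy(2) j[OF xy(2)]] by (metis imageI)
    next
      assume xy: "x \<notin> S" "y \<notin> S"
      then have "\<rho> x = \<rho> y" "x \<in> R" "y \<in> R" using that(1-3) by (auto simp: \<phi>_def)
      then show ?thesis using h(2) xy(1) by (simp add: inj_on_eq_iff)
    qed
    then show "x = y" "x \<in> S \<Longrightarrow> i x = j x" by auto
  qed
  have im: "t = t'" if asm: "\<phi> i ` t = \<phi> j ` t'" "t \<in> T" "t' \<in> T" "i \<in> I" "j \<in> I" for i j t t'
  proof -
    have "x \<in> t'" if x: "x \<in> t" for x
    proof -
      have "\<phi> i x \<in> \<phi> j ` t'" using x asm(1) by (metis imageI)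
      then obtain y where y: "y \<in> t'" "\<phi> i x = \<phi> j y" by (rule imageE)
      have "x \<in> R \<union> S" "y \<in> R \<union> S" using T(1)[OF \<open>t \<in> T\<close>] T(1)[OF \<open>t' \<in> T\<close>] x y(1) by auto
      then have "x = y" using coord(1)[OF y(2)] \<open>i \<in> I\<close> \<open>j \<in> I\<close> by simp
      then show ?thesis using y by simp
    qed
    moreover have "x \<in> t" if x: "x \<in> t'" for x
    proof -
      have "\<phi> j x \<in> \<phi> i ` t" using x asm(1) by (metis imageI)
      then obtain y where y: "y \<in> t" "\<phi> i y = \<phi> j x" by (metis imageE)
      have "x \<in> R \<union> S" "y \<in> R \<union> S" using T(1)[OF \<open>t \<in> T\<close>] T(1)[OF \<open>t' \<in> T\<close>] x y(1) by auto
      then have "y = x" using coord(1)[OF y(2)] \<open>i \<in> I\<close> \<open>j \<in> I\<close> by simp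
      then show ?thesis using y by simp
    qed
    ultimately show ?thesis by blast
  qed
  define Ti where "Ti i = (\<lambda>t. \<phi> i ` t) ` T" for i
  have TiE: "Ti i \<subseteq> E" if "i \<in> I" for i
    using E that unfolding Ti_def \<phi>_def I_def by blast
  have cardTi: "card (Ti i) = card T" if "i \<in> I" for i
    unfolding Ti_def by (rule card_image) (use im that in \<open>auto simp: inj_on_def\<close>)
  have cap: "card (Ti i \<inter> Ti j) \<le> e {x \<in> S. i x = j x}" if ij: "i \<in> I" "j \<in> I" for i j
  proof -
    have "Ti i \<inter> Ti j \<subseteq> (\<lambda>t. \<phi> i ` t) ` {t \<in> T. t \<subseteq> R \<union> {x \<in> S. i x = j x}}"
    proof
      fix z assume "z \<in> Ti i \<inter> Ti j"
      then obtain t t' where t: "t \<in> T" "t' \<in> T" "z = \<phi> i ` t" "\<phi> i ` t = \<phi> j ` t'"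
        unfolding Ti_def by auto
      then have tt: "t' = t" using im[of i t j t'] ij by (simp only:)
      have "x \<in> R \<union> {x \<in> S. i x = j x}" if x: "x \<in> t" for x
      proof -
        have "\<phi> i x \<in> \<phi> j ` t" using x t(4) tt by (metis imageI)
        then obtain y where y: "y \<in> t" "\<phi> i x = \<phi> j y" by (rule imageE)
        have "x \<in> R \<union> S" "y \<in> R \<union> S" using T(1)[OF t(1)] x y(1) by auto
        then show ?thesis using coord(2)[OF y(2) _ _ ij] by auto
      qed
      then show "z \<in> (\<lambda>t. \<phi> i ` t) ` {t \<in> T. t \<subseteq> R \<union> {x \<in> S. i x = j x}}" using t by blast
    qed
    moreover have "finite {t \<in> T. t \<subseteq> R \<union> {x \<in> S. i x = j x}}" using fin by simp
    ultimately show ?thesis unfolding e_def by (meson card_image_le card_mono finite_imageI le_trans)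
  qed
  have inner: "(\<Sum>j\<in>I. (1 / p) ^ card (Ti i \<inter> Ti j))
      \<le> (\<Sum>A\<in>Pow S. real w ^ (card S - card A) * (1 / p) ^ e A)" if i: "i \<in> I" for i
  proof -
    have "(\<Sum>j\<in>I. (1 / p) ^ card (Ti i \<inter> Ti j)) \<le> (\<Sum>j\<in>I. (1 / p) ^ e {x \<in> S. i x = j x})"
      using cap[OF i] p by (intro sum_mono power_increasing) auto
    also have "\<dots> = (\<Sum>A\<in>Pow S. \<Sum>j\<in>{j \<in> I. {x \<in> S. i x = j x} = A}. (1 / p) ^ e {x \<in> S. i x = j x})"
      using fin I by (intro sum.group[symmetric]) auto
    also have "\<dots> = (\<Sum>A\<in>Pow S. real (card {j \<in> I. {x \<in> S. i x = j x} = A}) * (1 / p) ^ e A)"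
      by (intro sum.cong refl) simp
    also have "\<dots> \<le> (\<Sum>A\<in>Pow S. real w ^ (card S - card A) * (1 / p) ^ e A)"
    proof (intro sum_mono mult_right_mono)
      fix A assume A: "A \<in> Pow S"
      \<comment> \<open>Agreement is imposed on \<open>A\<close> but not excluded elsewhere; this
        overcount turns the index set into a product.\<close>
      let ?J = "Pi\<^sub>E S (\<lambda>x. if x \<in> A then {i x} else {..<w})"
      have sub: "{j \<in> I. {x \<in> S. i x = j x} = A} \<subseteq> ?J"
        unfolding I_def by (auto simp: PiE_iff extensional_def)
      have "card {j \<in> I. {x \<in> S. i x = j x} = A} \<le> card ?J"
        using fin sub by (intro card_mono finite_PiE) auto
      also have "card ?J = (\<Prod>x\<in>S. if x \<in> A then 1 else w)"
        using fin by (simp add: card_PiE if_distrib cong: if_cong)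
      also have "\<dots> = w ^ card (S - A)"
        using fin by (simp add: prod.If_cases Diff_eq)
      also have "card (S - A) = card S - card A"
        using A fin by (simp add: card_Diff_subset finite_subset)
      finally show "real (card {j \<in> I. {x \<in> S. i x = j x} = A}) \<le> real w ^ (card S - card A)"
        unfolding of_nat_power[symmetric] of_nat_le_iff .
    qed (use p in auto)
    finally show ?thesis .
  qed
  \<comment> \<open>No template edge joins roots only, so \<open>A = {}\<close> contributes exactly
    1 to the normalised sum. This cancels the - 1 of the second moment bound and leaves the sum over
    nonempty \<open>A\<close>.\<close>
  have e0: "e {} = 0" unfolding e_def using T(2) by (simp add: card_eq_0_iff)
  have ratio: "real w ^ (card S - card A) = real w ^ card S * (1 / real w) ^ card A" if "A \<subseteq> S" for A
  proof -
    have "card A \<le> card S" using that fin by (simp add: card_mono)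
    then show ?thesis using w by (simp add: power_diff power_divide)
  qed
  have "(\<Sum>i\<in>I. \<Sum>j\<in>I. (1 / p) ^ card (Ti i \<inter> Ti j))
      \<le> (\<Sum>i\<in>I. \<Sum>A\<in>Pow S. real w ^ (card S - card A) * (1 / p) ^ e A)"
    by (intro sum_mono inner)
  also have "\<dots> = real w ^ card S * (\<Sum>A\<in>Pow S. real w ^ (card S - card A) * (1 / p) ^ e A)"
    by (simp add: I)
  also have "(\<Sum>A\<in>Pow S. real w ^ (card S - card A) * (1 / p) ^ e A)
      = real w ^ card S * (\<Sum>A\<in>Pow S. (1 / real w) ^ card A * (1 / p) ^ e A)"
    unfolding sum_distrib_left using ratio by (intro sum.cong refl) simp
  also have "(\<Sum>A\<in>Pow S. (1 / real w) ^ card A * (1 / p) ^ e A)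
      = 1 + (\<Sum>A\<in>Pow S - {{}}. (1 / real w) ^ card A * (1 / p) ^ e A)"
    using fin e0 by (subst sum.remove[of _ "{}"]) auto
  finally have le: "(\<Sum>i\<in>I. \<Sum>j\<in>I. (1 / p) ^ card (Ti i \<inter> Ti j))
      \<le> real w ^ card S * (real w ^ card S * (1 + (\<Sum>A\<in>Pow S - {{}}. (1 / real w) ^ card A * (1 / p) ^ e A)))" .
  have cI: "real (card I) ^ 2 = real w ^ card S * real w ^ card S" "0 < real w ^ card S * real w ^ card S"
    using w by (simp_all add: I power2_eq_square)
  have main: "(\<Sum>i\<in>I. \<Sum>j\<in>I. (1 / p) ^ card (Ti i \<inter> Ti j)) / real (card I) ^ 2 - 1
      \<le> (\<Sum>A\<in>Pow S - {{}}. (1 / real w) ^ card A * (1 / p) ^ e A)"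
  proof -
    have "X / (W * W) - 1 \<le> Z" if "X \<le> W * (W * (1 + Z))" "0 < W * W" for X W Z :: real
    proof -
      have "X / (W * W) \<le> 1 + Z" using that by (simp add: pos_divide_le_eq mult_ac)
      then show ?thesis by simp
    qed
    from this[OF le cI(2)] show ?thesis unfolding cI(1) .
  qed
  have "bernoulli_exp p E (\<lambda>G. of_bool (\<forall>i\<in>I. \<not> Ti i \<subseteq> G))
      \<le> (\<Sum>i\<in>I. \<Sum>j\<in>I. (1 / p) ^ card (Ti i \<inter> Ti j)) / real (card I) ^ 2 - 1"
    using fin I Ine p TiE cardTi by (intro bernoulli_second_moment) auto
  also note main
  finally show ?thesis
    unfolding Ti_def image_subset_iff \<phi>_def I_def e_def .
qed

section \<open>Percolation and balanced graphs\<close>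

definition edges_in :: "'a set set \<Rightarrow> 'a set \<Rightarrow> 'a set set" where
  "edges_in T B = {t \<in> T. t \<subseteq> B}"

text \<open>Strictness of \<open>F \<subset> {0..<k}\<close> matters: the full vertex set spans
  \<lambda> (k - 2) + 2 edges, one more than the bound grants to a proper subset.
  \<open>3 \<le> k\<close> keeps the denominator of \<open>lambda_H\<close> positive.\<close>

definition balanced_graph :: "nat \<Rightarrow> nat set set \<Rightarrow> bool" where
  "balanced_graph k EH \<longleftrightarrow> EH \<subseteq> all_edges k \<and> 3 \<le> k \<and> 1 \<le> lambda_H k EH \<and>
     (\<forall>F. F \<subset> {0..<k} \<longrightarrow> 2 \<le> card F \<longrightarrow>
        real (card (edges_in EH F)) \<le> lambda_H k EH * (real (card F) - 2) + 1)"

lemma all_edges_altdef: "all_edges n = {e. e \<subseteq> {0..<n} \<and> card e = 2}"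
  unfolding all_edges_def by (force simp: card_2_iff)

lemma finite_all_edges [simp]: "finite (all_edges n)"
  unfolding all_edges_altdef by (rule finite_subset[of _ "Pow {0..<n}"]) auto

lemma lambda_H_mult: "3 \<le> k \<Longrightarrow> lambda_H k EH * (real k - 2) = real (card EH) - 2"
  unfolding lambda_H_def by simp

lemma balanced_graph_edges:
  assumes "balanced_graph k EH"
  shows "finite EH" "3 \<le> card EH"
proof -
  show "finite EH" using assms finite_subset[of EH "all_edges k"] unfolding balanced_graph_def by simp
  have "1 * (real k - 2) \<le> lambda_H k EH * (real k - 2)"
    using assms unfolding balanced_graph_def by (intro mult_right_mono) auto
  then show "3 \<le> card EH" using assms lambda_H_mult[of k EH] unfolding balanced_graph_def by auto
qed

lemma perc_steps_mono: "s \<le> t \<Longrightarrow> (perc_step n k EH ^^ s) G \<subseteq> (perc_step n k EH ^^ t) G"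
proof (induction rule: dec_induct)
  case (step t)
  then show ?case by (auto simp: perc_step_def)
qed simp

lemma perc_closure_superset: "G \<subseteq> perc_closure n k EH G"
proof -
  have "(perc_step n k EH ^^ 0) G \<subseteq> perc_closure n k EH G" unfolding perc_closure_def by blast
  then show ?thesis by simp
qed

text \<open>The closure is a union over all times, but the copy has finitely many edges: at the
  maximum of their infection times all but one are present, and one more step adds the last.\<close>

lemma perc_closure_step:
  assumes "EH \<subseteq> all_edges k" "x0 \<in> EH" "inj_on f {0..<k}" "f ` {0..<k} \<subseteq> {0..<n}"
    and copy: "\<And>x. x \<in> EH \<Longrightarrow> x \<noteq> x0 \<Longrightarrow> f ` x \<in> perc_closure n k EH G"
  shows "f ` x0 \<in> perc_closure n k EH G"
proof -
  have "\<exists>t. \<forall>x\<in>EH - {x0}. f ` x \<in> (perc_step n k EH ^^ t) G"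
  proof -
    have "\<forall>x\<in>EH - {x0}. \<exists>t. f ` x \<in> (perc_step n k EH ^^ t) G"
      using copy unfolding perc_closure_def by blast
    then obtain \<tau> where \<tau>: "\<And>x. x \<in> EH - {x0} \<Longrightarrow> f ` x \<in> (perc_step n k EH ^^ \<tau> x) G"
      by metis
    have "finite EH" using assms(1) finite_subset by fastforce
    then have "\<tau> x \<le> Max (\<tau> ` EH)" if "x \<in> EH" for x using that by simp
    then have "\<forall>x\<in>EH - {x0}. f ` x \<in> (perc_step n k EH ^^ Max (\<tau> ` EH)) G"
      using \<tau> perc_steps_mono by (metis Diff_iff subsetD)
    then show ?thesis by blast
  qed
  then obtain t where t: "\<And>x. x \<in> EH - {x0} \<Longrightarrow> f ` x \<in> (perc_step n k EH ^^ t) G" by blast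
  let ?X = "(perc_step n k EH ^^ t) G"
  have x0: "x0 \<subseteq> {0..<k}" "card x0 = 2" using assms(1,2) unfolding all_edges_altdef by auto
  then have "card (f ` x0) = 2" using assms(3) by (metis card_image inj_on_subset)
  then have "f ` x0 \<in> all_edges n" using x0 assms(4) unfolding all_edges_altdef by auto
  moreover have "has_copy_containing n k EH (?X \<union> {f ` x0}) (f ` x0)"
  proof -
    have "\<forall>x\<in>EH. f ` x \<in> ?X \<union> {f ` x0}"
    proof
      fix x assume "x \<in> EH"
      then show "f ` x \<in> ?X \<union> {f ` x0}" using t[of x] by (cases "x = x0") auto
    qed
    then show ?thesis unfolding has_copy_containing_def using assms(2-4) by blast
  qed
  ultimately have "f ` x0 \<in> perc_step n k EH ?X" unfolding perc_step_def by blast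
  then have "f ` x0 \<in> (perc_step n k EH ^^ Suc t) G" by simp
  then show ?thesis unfolding perc_closure_def by blast
qed

text \<open>The way to bound the closure from above: exhibit a superset of \<open>G\<close> to which
  no copy can force a new edge. Enlarging the graph preserves copies, so induction over time
  applies.\<close>

lemma perc_closure_least:
  assumes "G \<subseteq> X"
    and closed: "\<And>e. e \<in> all_edges n \<Longrightarrow> has_copy_containing n k EH (X \<union> {e}) e \<Longrightarrow> e \<in> X"
  shows "perc_closure n k EH G \<subseteq> X"
proof -
  have "(perc_step n k EH ^^ t) G \<subseteq> X" for t
  proof (induction t)
    case (Suc t)
    have "has_copy_containing n k EH (X \<union> {e}) e"
      if "has_copy_containing n k EH ((perc_step n k EH ^^ t) G \<union> {e}) e" for e
    proof -
      from that obtain f where f: "inj_on f {0..<k}" "f ` {0..<k} \<subseteq> {0..<n}"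
        "\<forall>x\<in>EH. f ` x \<in> (perc_step n k EH ^^ t) G \<union> {e}" "e \<in> (\<lambda>x. f ` x) ` EH"
        unfolding has_copy_containing_def by blast
      then have "\<forall>x\<in>EH. f ` x \<in> X \<union> {e}" using Suc by blast
      then show ?thesis using f unfolding has_copy_containing_def by blast
    qed
    then have "perc_step n k EH ((perc_step n k EH ^^ t) G) \<subseteq> X"
      using Suc closed unfolding perc_step_def[of n k EH "(perc_step n k EH ^^ t) G"] by blast
    then show ?case by simp
  qed (use assms in simp)
  then show ?thesis unfolding perc_closure_def by blast
qed

section \<open>Upper bound on the threshold\<close>

text \<open>Here \<open>f\<close> is the future root and \<open>g\<close> the edge at which the
  older chain is attached. With both removed, a copy carries at most \<lambda> edges per non-root
  vertex, with equality on the whole vertex set. The edge saved when a proper \<open>F\<close>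
  contains \<open>g\<close> will pay for the excess edge of the chain attached there.\<close>

lemma balanced_two_edges_removed:
  assumes bal: "balanced_graph k EH" and f: "f \<in> EH" "g \<in> EH" "f \<noteq> g" and F: "F \<subseteq> {0..<k}"
  shows "real (card (edges_in (EH - {f, g}) F))
    \<le> lambda_H k EH * real (card (F - f)) - of_bool (g \<subseteq> F \<and> F \<noteq> {0..<k})"
proof -
  let ?l = "lambda_H k EH"
  have H: "finite EH" "3 \<le> card EH" "1 \<le> ?l" "EH \<subseteq> all_edges k" "3 \<le> k"
    using bal balanced_graph_edges[OF bal] unfolding balanced_graph_def by auto
  have f2: "card f = 2" "f \<subseteq> {0..<k}" and g2: "card g = 2" "g \<subseteq> {0..<k}"
    using f H unfolding all_edges_altdef by auto
  have finF: "finite F" using F finite_subset by blast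
  have finf: "finite f" "finite g" using f2 g2 card_ge_0_finite[of f] card_ge_0_finite[of g] by auto
  have edge2: "card t = 2" if "t \<in> EH" for t using that H unfolding all_edges_altdef by auto
  consider "F = {0..<k}" | "card F < 2" | "F \<subset> {0..<k}" "2 \<le> card F" using F by fastforce
  then show ?thesis
  proof cases
    case 1
    have "card (edges_in (EH - {f, g}) F) \<le> card (EH - {f, g})"
      unfolding edges_in_def using H by (intro card_mono) auto
    also have "card (EH - {f, g}) = card EH - 2"
      using f H by (subst card_Diff_subset) auto
    finally have "real (card (edges_in (EH - {f, g}) F)) \<le> real (card EH) - 2" using H by linarith
    moreover have "card (F - f) = k - 2" using 1 f2 finf by (simp add: card_Diff_subset)
    ultimately show ?thesis using 1 H lambda_H_mult[of k EH] by (simp add: of_nat_diff)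
  next
    case 2
    then have small: "\<not> t \<subseteq> F" if "card t = 2" for t
      using that card_mono[OF finF, of t] by auto
    have empty: "edges_in (EH - {f, g}) F = {}"
      unfolding edges_in_def using edge2 small by auto
    show ?thesis using small[OF g2(1)] H unfolding empty by simp
  next
    case 3
    have fin: "finite (edges_in EH F)" unfolding edges_in_def using H by simp
    have bound: "real (card (edges_in EH F)) \<le> ?l * (real (card F) - 2) + 1"
      using bal 3 unfolding balanced_graph_def by blast
    have eq: "edges_in (EH - {f, g}) F = edges_in EH F - {f, g}" unfolding edges_in_def by auto
    show ?thesis
    proof (cases "f \<subseteq> F")
      case True
      have "card (edges_in EH F - {f, g}) + card (edges_in EH F \<inter> {f, g}) = card (edges_in EH F)"
        using fin by (metis Int_Diff_Un Int_Diff_disjoint Un_commute card_Un_disjoint finite_Diff finite_Int inf_commute)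
      moreover have "card (edges_in EH F \<inter> {f, g}) = 1 + of_bool (g \<subseteq> F)"
      proof (cases "g \<subseteq> F")
        case g: True
        then have "edges_in EH F \<inter> {f, g} = {f, g}" using True f unfolding edges_in_def by auto
        then show ?thesis using g f by simp
      next
        case g: False
        then have "edges_in EH F \<inter> {f, g} = {f}" using True f unfolding edges_in_def by auto
        then show ?thesis using g by simp
      qed
      moreover have "real (card (F - f)) = real (card F) - 2"
        using True f2 finf 3 by (simp add: card_Diff_subset of_nat_diff)
      ultimately show ?thesis using bound 3 unfolding eq by auto
    next
      case False
      have "card (F \<inter> f) < 2"
        using False f2 finf by (metis Int_lower2 card_subset_eq inf_le1 le_neq_implies_less card_mono)
      moreover have "card (F - f) = card F - card (F \<inter> f)" using finF by (simp add: card_Diff_subset_Int)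
      ultimately have "real (card (F - f)) \<ge> real (card F) - 1" using 3 by linarith
      \<comment> \<open>At most one root lies in \<open>F\<close>, so at least
        \<open>card F - 1\<close> vertices are charged instead of \<open>card F - 2\<close>; since
        \<open>1 \<le> ?l\<close>, the additional vertex pays for the + 1 in
        \<open>bound\<close>.\<close>
      then have "?l * real (card (F - f)) \<ge> ?l * (real (card F) - 1)" using H by (intro mult_left_mono) auto
      then have lb: "?l * real (card (F - f)) \<ge> ?l * (real (card F) - 2) + 1"
        using H by (simp add: algebra_simps)
      have "card (edges_in EH F - {f, g}) + of_bool (g \<subseteq> F) \<le> card (edges_in EH F)"
      proof (cases "g \<subseteq> F")
        case g: True
        then have "g \<in> edges_in EH F" using f unfolding edges_in_def by auto
        then have "card (edges_in EH F - {f, g}) < card (edges_in EH F)"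
          using fin by (intro psubset_card_mono) auto
        then show ?thesis using g by simp
      qed (use fin in \<open>simp add: card_mono\<close>)
      then have "real (card (edges_in EH F - {f, g})) + of_bool (g \<subseteq> F) \<le> real (card (edges_in EH F))"
        by (metis of_nat_add of_nat_le_iff of_nat_of_bool)
      moreover have "of_bool (g \<subseteq> F \<and> F \<noteq> {0..<k}) \<le> (of_bool (g \<subseteq> F) :: real)" by simp
      ultimately show ?thesis using bound lb unfolding eq by linarith
    qed
  qed
qed

text \<open>\<open>a\<close> and \<open>b\<close> are the roots. The full template exceeds \<lambda>
  edges per non-root vertex by one, while proper parts may not exceed it; this asymmetry is what
  survives gluing. The last clause ranges over all embeddings because a gadget is relabelled when it
  becomes part of a larger one.\<close>

definition gadget :: "nat \<Rightarrow> nat set set \<Rightarrow> nat set \<Rightarrow> nat set set \<Rightarrow> nat \<Rightarrow> nat \<Rightarrow> bool" where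
  "gadget k EH V T a b \<longleftrightarrow> finite V \<and> a \<in> V \<and> b \<in> V \<and> a \<noteq> b \<and>
     (\<forall>t\<in>T. t \<subseteq> V \<and> card t = 2) \<and>
     real (card T) = lambda_H k EH * (real (card V) - 2) + 1 \<and>
     (\<forall>B. B \<subset> V \<longrightarrow> real (card (edges_in T B)) \<le> lambda_H k EH * real (card (B - {a, b}))) \<and>
     (\<forall>n \<phi> G. inj_on \<phi> V \<longrightarrow> \<phi> ` V \<subseteq> {0..<n} \<longrightarrow> (\<forall>t\<in>T. \<phi> ` t \<in> G) \<longrightarrow>
        {\<phi> a, \<phi> b} \<in> perc_closure n k EH G)"

lemma gadget_finite: "gadget k EH V T a b \<Longrightarrow> finite T"
  unfolding gadget_def by (intro finite_subset[of T "Pow V"]) auto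

lemma gadget_single_edge: "1 \<le> lambda_H k EH \<Longrightarrow> gadget k EH {0, 1} {{0, 1}} 0 1"
proof -
  assume "1 \<le> lambda_H k EH"
  have "edges_in {{0, 1::nat}} B = {}" if "B \<subset> {0, 1}" for B
    using that unfolding edges_in_def by auto
  then show ?thesis unfolding gadget_def
    using subsetD[OF perc_closure_superset] \<open>1 \<le> lambda_H k EH\<close> by auto
qed

text \<open>The root of the old gadget is glued onto an edge $g$ of $H$; another edge $f$ of $H$ becomes the new root.\<close>

lemma gadget_extend:
  assumes bal: "balanced_graph k EH" and gad: "gadget k EH V T a b"
  shows "\<exists>V' T' a' b'. gadget k EH V' T' a' b' \<and> card V' = card V + (k - 2)"
proof -
  let ?l = "lambda_H k EH"
  have H: "finite EH" "3 \<le> card EH" "1 \<le> ?l" "EH \<subseteq> all_edges k" "3 \<le> k"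
    using bal balanced_graph_edges[OF bal] unfolding balanced_graph_def by auto
  obtain f g where fg: "f \<in> EH" "g \<in> EH" "f \<noteq> g"
  proof -
    obtain f where f: "f \<in> EH" using H by fastforce
    have "card (EH - {f}) > 0" using H f by simp
    then obtain g where "g \<in> EH - {f}" by (metis card_gt_0_iff ex_in_conv)
    then show ?thesis using that f by blast
  qed
  obtain a' b' where f: "f = {a', b'}" "a' < k" "b' < k" "a' \<noteq> b'"
    using fg H unfolding all_edges_def by blast
  obtain u w where g: "g = {u, w}" "u < k" "w < k" "u \<noteq> w"
    using fg H unfolding all_edges_def by blast
  have V: "finite V" "a \<in> V" "b \<in> V" "a \<noteq> b" and T2: "\<And>t. t \<in> T \<Longrightarrow> t \<subseteq> V" "\<And>t. t \<in> T \<Longrightarrow> card t = 2"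
    and cT: "real (card T) = ?l * (real (card V) - 2) + 1"
    and dens: "\<And>B. B \<subset> V \<Longrightarrow> real (card (edges_in T B)) \<le> ?l * real (card (B - {a, b}))"
    and act: "\<And>n \<phi> G. inj_on \<phi> V \<Longrightarrow> \<phi> ` V \<subseteq> {0..<n} \<Longrightarrow> \<forall>t\<in>T. \<phi> ` t \<in> G \<Longrightarrow>
        {\<phi> a, \<phi> b} \<in> perc_closure n k EH G"
    using gad unfolding gadget_def by auto
  have finT: "finite T" using gadget_finite[OF gad] .
  \<comment> \<open>The roots go to the endpoints of \<open>g\<close> and all other vertices are
    shifted beyond \<open>k\<close>, so the old gadget meets the new copy in \<open>u\<close> and
    \<open>w\<close> only.\<close>
  define s where "s x = (if x = a then u else if x = b then w else x + k)" for x :: nat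
  have s_inj: "inj s" unfolding inj_def s_def using g by auto
  then have s_on: "inj_on s A" for A by (rule inj_on_subset) simp
  have s_low: "s x < k \<longleftrightarrow> x = a \<or> x = b" for x unfolding s_def using g by auto
  have s_ab: "s a = u" "s b = w" unfolding s_def using V by auto
  define V' where "V' = {0..<k} \<union> s ` V"
  define T1 where "T1 = EH - {f, g}"
  define T' where "T' = T1 \<union> (\<lambda>t. s ` t) ` T"
  have cap: "{0..<k} \<inter> s ` V = {u, w}"
    using s_low s_ab V g by auto
  have cV': "card V' = card V + (k - 2)"
  proof -
    have "card {0..<k} + card (s ` V) = card V' + card {u, w}"
      unfolding V'_def using V cap by (metis card_Un_Int finite_atLeastLessThan finite_imageI)
    then show ?thesis using g s_on H by (simp add: card_image)
  qed
  have T1: "t \<subseteq> {0..<k}" "card t = 2" if "t \<in> T1" for t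
    using that H unfolding T1_def all_edges_altdef by auto
  \<comment> \<open>A common edge would lie within \<open>{u, w}\<close> and hence be
    \<open>g\<close>, which \<open>T1\<close> omits.\<close>
  have disj: "T1 \<inter> (\<lambda>t. s ` t) ` T = {}"
  proof (rule ccontr)
    assume "T1 \<inter> (\<lambda>t. s ` t) ` T \<noteq> {}"
    then obtain t where t: "t \<in> T" "s ` t \<in> T1" by auto
    then have "s ` t \<subseteq> g" using T1(1)[OF t(2)] T2(1)[OF t(1)] cap g by auto
    moreover have "card (s ` t) = 2" using T1(2) t by blast
    moreover have "card g = 2" "finite g" using g by auto
    ultimately have "s ` t = g" by (simp add: card_subset_eq)
    then show False using t unfolding T1_def by simp
  qed
  have inj_im: "inj_on (\<lambda>t. s ` t) T" using s_inj by (simp add: inj_on_def inj_image_eq_iff)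
  have cT1: "card T1 = card EH - 2" unfolding T1_def using fg H by (subst card_Diff_subset) auto
  have finT1: "finite T1" unfolding T1_def using H by simp
  have cT': "real (card T') = ?l * (real (card V') - 2) + 1"
  proof -
    have "card T' = card T1 + card T"
      unfolding T'_def using disj finT finT1 inj_im by (simp add: card_Un_disjoint card_image)
    then have "real (card T') = real (card EH) - 2 + real (card T)" using cT1 H by simp
    also have "\<dots> = ?l * (real k - 2) + (?l * (real (card V) - 2) + 1)"
      using lambda_H_mult[of k EH] H cT by simp
    also have "\<dots> = ?l * (real (card V') - 2) + 1"
      using cV' H by (simp add: of_nat_diff algebra_simps)
    finally show ?thesis .
  qed
  have dens': "real (card (edges_in T' B)) \<le> ?l * real (card (B - {a', b'}))" if B: "B \<subset> V'" for B
  proof -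
    \<comment> \<open>\<open>B\<close> is split into its trace \<open>F\<close> on the new copy and
      its trace on the old gadget, pulled back to \<open>C\<close>. The glued vertices are charged
      to \<open>F\<close> only.\<close>
    define C where "C = {x \<in> V. s x \<in> B}"
    define F where "F = B \<inter> {0..<k}"
    have finC: "finite C" "finite F" "finite B"
      using V B unfolding C_def F_def V'_def by (auto intro: finite_subset)
    have "edges_in T' B \<subseteq> edges_in T1 F \<union> (\<lambda>t. s ` t) ` edges_in T C"
    proof
      fix t assume "t \<in> edges_in T' B"
      then have t: "t \<subseteq> B" "t \<in> T1 \<or> t \<in> (\<lambda>t. s ` t) ` T"
        unfolding edges_in_def T'_def by auto
      from t(2) show "t \<in> edges_in T1 F \<union> (\<lambda>t. s ` t) ` edges_in T C"
      proof
        assume "t \<in> T1"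
        then show ?thesis using t(1) T1(1)[of t] unfolding edges_in_def F_def by auto
      next
        assume "t \<in> (\<lambda>t. s ` t) ` T"
        then obtain r where r: "r \<in> T" "t = s ` r" by blast
        then have "r \<in> edges_in T C"
          using t(1) T2(1)[OF r(1)] unfolding edges_in_def C_def by auto
        then show ?thesis using r by blast
      qed
    qed
    then have "card (edges_in T' B) \<le> card (edges_in T1 F \<union> (\<lambda>t. s ` t) ` edges_in T C)"
      using finT finT1 by (intro card_mono) (auto simp: edges_in_def)
    also have "\<dots> \<le> card (edges_in T1 F) + card ((\<lambda>t. s ` t) ` edges_in T C)"
      by (rule card_Un_le)
    also have "\<dots> \<le> card (edges_in T1 F) + card (edges_in T C)"
      using finT by (simp add: card_image_le edges_in_def)
    finally have le1: "real (card (edges_in T' B)) \<le> real (card (edges_in T1 F)) + real (card (edges_in T C))"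
      by linarith
    have "card (F - f) + card (C - {a, b}) = card ((F - f) \<union> s ` (C - {a, b}))"
    proof -
      have "(F - f) \<inter> s ` (C - {a, b}) = {}"
      proof -
        have "s x \<notin> F" if "x \<in> C - {a, b}" for x using that s_low[of x] unfolding F_def by simp
        then show ?thesis by blast
      qed
      then show ?thesis using finC s_on by (simp add: card_Un_disjoint card_image)
    qed
    also have "\<dots> \<le> card (B - f)"
    proof (rule card_mono)
      have "s x \<in> B - f" if "x \<in> C - {a, b}" for x
        using that s_low[of x] f unfolding C_def by auto
      then show "(F - f) \<union> s ` (C - {a, b}) \<subseteq> B - f" unfolding F_def by blast
    qed (use finC in simp)
    finally have "?l * (real (card (F - f)) + real (card (C - {a, b}))) \<le> ?l * real (card (B - f))"
      using H by (intro mult_left_mono) linarith+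
    then have le2: "?l * real (card (F - f)) + ?l * real (card (C - {a, b})) \<le> ?l * real (card (B - f))"
      by (simp add: distrib_left)
    have T1F: "real (card (edges_in T1 F)) \<le> ?l * real (card (F - f)) - of_bool (g \<subseteq> F \<and> F \<noteq> {0..<k})"
      unfolding T1_def by (rule balanced_two_edges_removed[OF bal fg]) (simp add: F_def)
    have "real (card (edges_in T1 F)) + real (card (edges_in T C))
      \<le> ?l * real (card (F - f)) + ?l * real (card (C - {a, b}))"
    \<comment> \<open>If \<open>B\<close> misses part of the old gadget, both densities add up. If
      it contains the gadget entirely, the excess edge appears, but then
      \<open>g \<subseteq> F\<close>, and \<open>F\<close> is proper because \<open>B\<close> is, so
      the saved edge compensates.\<close>
    proof (cases "C = V")
      case False
      then have "C \<subset> V" unfolding C_def by auto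
      from dens[OF this] show ?thesis using T1F
        by (simp add: of_bool_def split: if_splits)
    next
      case True
      then have sV: "s ` V \<subseteq> B" unfolding C_def by auto
      then have "g \<subseteq> F" using V s_ab g unfolding F_def by auto
      moreover have "F \<noteq> {0..<k}" using sV B unfolding F_def V'_def by auto
      moreover have "card (edges_in T C) \<le> card T"
        unfolding edges_in_def using finT by (intro card_mono) auto
      moreover have "real (card (C - {a, b})) = real (card V) - 2"
      proof -
        have "card {a, b} \<le> card V" using V by (intro card_mono) auto
        then show ?thesis using True V by (simp add: card_Diff_subset of_nat_diff)
      qed
      ultimately show ?thesis using T1F cT by simp
    qed
    then show ?thesis using le1 le2 f by simp
  qed
  have act': "{\<phi> a', \<phi> b'} \<in> perc_closure n k EH G"
    if \<phi>: "inj_on \<phi> V'" "\<phi> ` V' \<subseteq> {0..<n}" "\<forall>t\<in>T'. \<phi> ` t \<in> G" for n \<phi> G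
  proof -
    have "inj_on (\<phi> \<circ> s) V"
      using \<phi>(1) s_inj unfolding V'_def by (meson Un_upper2 comp_inj_on inj_on_subset subset_UNIV)
    moreover have "(\<phi> \<circ> s) ` V \<subseteq> {0..<n}" using \<phi>(2) unfolding V'_def by auto
    moreover have "\<forall>t\<in>T. (\<phi> \<circ> s) ` t \<in> G"
    proof
      fix t assume "t \<in> T"
      then have "\<phi> ` (s ` t) \<in> G" using \<phi>(3) unfolding T'_def by blast
      then show "(\<phi> \<circ> s) ` t \<in> G" by (simp only: image_comp)
    qed
    ultimately have "{(\<phi> \<circ> s) a, (\<phi> \<circ> s) b} \<in> perc_closure n k EH G" by (rule act)
    then have img: "\<phi> ` g \<in> perc_closure n k EH G" using s_ab g by simp
    have "\<phi> ` f \<in> perc_closure n k EH G"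
    proof (rule perc_closure_step[OF H(4) fg(1)])
      show "inj_on \<phi> {0..<k}" using \<phi>(1) unfolding V'_def by (meson Un_upper1 inj_on_subset)
      show "\<phi> ` {0..<k} \<subseteq> {0..<n}" using \<phi>(2) unfolding V'_def by auto
      fix x assume "x \<in> EH" "x \<noteq> f"
      then show "\<phi> ` x \<in> perc_closure n k EH G"
        using img \<phi>(3) perc_closure_superset[of G n k EH] unfolding T'_def T1_def by blast
    qed
    then show ?thesis using f by simp
  qed
  have "gadget k EH V' T' a' b'"
    unfolding gadget_def
  proof (intro conjI allI impI)
    show "\<forall>t\<in>T'. t \<subseteq> V' \<and> card t = 2"
      using T1 T2 card_image[OF s_on] unfolding T'_def V'_def by fastforce
  qed (use V f cT' dens' act' in \<open>auto simp: V'_def\<close>)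
  then show ?thesis using cV' by blast
qed

lemma gadget_exists:
  assumes bal: "balanced_graph k EH"
  shows "\<exists>V T a b. gadget k EH V T a b \<and> card V = L * (k - 2) + 2"
proof (induction L)
  case 0
  have "gadget k EH {0, 1} {{0, 1}} 0 1"
    using bal by (intro gadget_single_edge) (simp add: balanced_graph_def)
  then show ?case by (intro exI conjI) (assumption, simp)
next
  case (Suc L)
  then obtain V T a b where "gadget k EH V T a b" "card V = L * (k - 2) + 2" by blast
  moreover from this obtain V' T' a' b' where "gadget k EH V' T' a' b'" "card V' = card V + (k - 2)"
    using gadget_extend[OF bal] by blast
  ultimately show ?case by (intro exI[of _ V'] exI[of _ T'] exI[of _ a'] exI[of _ b']) simp
qed

section \<open>Infection of every edge by independent attempts\<close>

lemma gnp_prob_eq: "gnp_prob n p P = bernoulli_exp p (all_edges n) (\<lambda>G. of_bool (P G))"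
proof -
  have "bernoulli_exp p (all_edges n) (\<lambda>G. of_bool (P G))
      = (\<Sum>G\<in>Pow (all_edges n). if P G then p ^ card G * (1 - p) ^ (card (all_edges n) - card G) else 0)"
    unfolding bernoulli_exp_def
    by (intro sum.cong refl) (auto simp: card_Diff_subset finite_subset[OF _ finite_all_edges])
  also have "\<dots> = gnp_prob n p P"
    unfolding gnp_prob_def by (subst sum.inter_filter[symmetric]) (auto intro!: sum.cong)
  finally show ?thesis ..
qed

lemma gnp_prob_le_1: "0 \<le> p \<Longrightarrow> p \<le> 1 \<Longrightarrow> gnp_prob n p P \<le> 1"
  using bernoulli_exp_mono[of p "all_edges n" "\<lambda>G. of_bool (P G)" "\<lambda>_. 1"]
  by (simp add: gnp_prob_eq bernoulli_exp_one)

lemma perc_closure_subset: "G \<subseteq> all_edges n \<Longrightarrow> perc_closure n k EH G \<subseteq> all_edges n"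
  by (rule perc_closure_least)

text \<open>The vertices other than \<open>x\<close> and \<open>y\<close> supply \<open>K\<close>
  disjoint groups of \<open>card S\<close> classes of size \<open>w\<close>, which explains
  \<open>K * (card S * w) \<le> n - 2\<close>. Attempts in different groups share no edge, so they
  fail independently, each with probability at most the second moment sum.\<close>

lemma edge_not_infected_bound:
  assumes gad: "gadget k EH V T a b" and x: "x < n" "y < n" "x \<noteq> y" and p: "0 < p" "p \<le> 1"
    and S: "S = V - {a, b}" "S \<noteq> {}" and w: "0 < w" "K * (card S * w) \<le> n - 2"
  shows "bernoulli_exp p (all_edges n) (\<lambda>G. of_bool ({x, y} \<notin> perc_closure n k EH G))
    \<le> (\<Sum>A\<in>Pow S - {{}}. (1 / real w) ^ card A * (1 / p) ^ card (edges_in T ({a, b} \<union> A))) ^ K"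
proof -
  have V: "finite V" "a \<in> V" "b \<in> V" "a \<noteq> b" and T2: "\<And>t. t \<in> T \<Longrightarrow> t \<subseteq> V" "\<And>t. t \<in> T \<Longrightarrow> card t = 2"
    and dens: "\<And>B. B \<subset> V \<Longrightarrow> real (card (edges_in T B)) \<le> lambda_H k EH * real (card (B - {a, b}))"
    and act: "\<And>n \<phi> G. inj_on \<phi> V \<Longrightarrow> \<phi> ` V \<subseteq> {0..<n} \<Longrightarrow> \<forall>t\<in>T. \<phi> ` t \<in> G \<Longrightarrow>
        {\<phi> a, \<phi> b} \<in> perc_closure n k EH G"
    using gad unfolding gadget_def by auto
  have finT: "finite T" using gadget_finite[OF gad] .
  have finS: "finite S" using S V by simp
  have V_eq: "V = {a, b} \<union> S" using S V by auto
  \<comment> \<open>The density bound for \<open>B = {a, b}\<close> has no vertex to charge, so it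
    forces zero edges; \<open>S \<noteq> {}\<close> makes this \<open>B\<close> proper.\<close>
  have noR: "\<not> t \<subseteq> {a, b}" if "t \<in> T" for t
  proof
    assume "t \<subseteq> {a, b}"
    then have "t \<in> edges_in T {a, b}" using that unfolding edges_in_def by simp
    moreover have "real (card (edges_in T {a, b})) \<le> 0"
    proof -
      have "{a, b} \<subset> V" using S V by blast
      from dens[OF this] show ?thesis by simp
    qed
    moreover have "finite (edges_in T {a, b})" unfolding edges_in_def using finT by simp
    ultimately show False by auto
  qed
  have "card ({..<K} \<times> S \<times> {..<w}) \<le> card ({0..<n} - {x, y})"
    using w x by (simp add: card_cartesian_product card_Diff_subset)
  then obtain h where h: "inj_on h ({..<K} \<times> S \<times> {..<w})" "h ` ({..<K} \<times> S \<times> {..<w}) \<subseteq> {0..<n} - {x, y}"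
    using inj_on_iff_card_le[of "{..<K} \<times> S \<times> {..<w}" "{0..<n} - {x, y}"] finS by auto
  have h_in: "h (j, z, c) \<in> {0..<n} - {x, y}" if "j < K" "z \<in> S" "c < w" for j z c
    using h(2) that by blast
  have h_inj: "j = j' \<and> z = z' \<and> c = c'" if "h (j, z, c) = h (j', z', c')"
    "j < K" "z \<in> S" "c < w" "j' < K" "z' \<in> S" "c' < w" for j z c j' z' c'
    using inj_onD[OF h(1) that(1)] that by auto
  define \<rho> where "\<rho> z = (if z = a then x else y)" for z
  define \<phi> where "\<phi> j i = (\<lambda>z. if z \<in> S then h (j, z, i z) else \<rho> z)" for j and i :: "nat \<Rightarrow> nat"
  define I where "I = (S \<rightarrow>\<^sub>E {..<w})"
  have iw: "i z < w" if "i \<in> I" "z \<in> S" for i z using that unfolding I_def by auto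
  have \<rho>_im: "\<rho> ` {a, b} = {x, y}" using V unfolding \<rho>_def by auto
  have \<phi>_inj: "inj_on (\<phi> j i) V" if "j < K" "i \<in> I" for j i
  proof (rule inj_onI)
    fix z z' assume z: "z \<in> V" "z' \<in> V" "\<phi> j i z = \<phi> j i z'"
    show "z = z'"
    proof (cases "z \<in> S"; cases "z' \<in> S")
      assume "z \<in> S" "z' \<in> S"
      then show ?thesis using h_inj[of j z "i z" j z' "i z'"] z(3) that iw[of i] unfolding \<phi>_def by simp
    next
      assume zz: "z \<in> S" "z' \<notin> S"
      then have "\<rho> z' \<in> {x, y}" using \<rho>_im z(2) V_eq by blast
      then show ?thesis using zz z(3) h_in[of j z "i z"] that iw[of i z] unfolding \<phi>_def by auto
    next
      assume zz: "z \<notin> S" "z' \<in> S"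
      then have "\<rho> z \<in> {x, y}" using \<rho>_im z(1) V_eq by blast
      then show ?thesis using zz z(3) h_in[of j z' "i z'"] that iw[of i z'] unfolding \<phi>_def by auto
    next
      assume zz: "z \<notin> S" "z' \<notin> S"
      then have "z \<in> {a, b}" "z' \<in> {a, b}" using z V_eq by auto
      then show ?thesis using zz z(3) x(3) V(4) unfolding \<phi>_def \<rho>_def by (auto split: if_splits)
    qed
  qed
  define W where "W j = {x, y} \<union> (\<lambda>(z, c). h (j, z, c)) ` (S \<times> {..<w})" for j
  \<comment> \<open>Different groups have only the vertices \<open>x\<close> and \<open>y\<close> in
    common, so removing the edge \<open>{x, y}\<close> makes their edge sets disjoint.\<close>
  define B where "B j = {e \<in> all_edges n. e \<subseteq> W j} - {{x, y}}" for j
  have \<phi>_W: "\<phi> j i z \<in> W j" if "i \<in> I" "z \<in> V" for j i z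
  proof (cases "z \<in> S")
    case True
    then show ?thesis using iw[OF that(1) True] unfolding \<phi>_def W_def by force
  next
    case False
    then have "\<rho> z \<in> {x, y}" using \<rho>_im that V_eq by blast
    then show ?thesis using False unfolding \<phi>_def W_def by auto
  qed
  have W_n: "W j \<subseteq> {0..<n}" if "j < K" for j
    using x h_in[OF that] unfolding W_def by auto
  have \<phi>_B: "\<phi> j i ` t \<in> B j" if jit: "j < K" "i \<in> I" "t \<in> T" for j i t
  proof -
    have "\<phi> j i ` t \<subseteq> W j" using \<phi>_W[OF jit(2)] T2(1)[OF jit(3)] by blast
    moreover have "card (\<phi> j i ` t) = 2"
      using card_image[OF inj_on_subset[OF \<phi>_inj[OF jit(1,2)] T2(1)[OF jit(3)]]] T2(2)[OF jit(3)] by simp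
    moreover have "\<phi> j i ` t \<noteq> {x, y}"
    proof -
      obtain z where z: "z \<in> t" "z \<in> S" using noR[OF jit(3)] T2(1)[OF jit(3)] V_eq by blast
      then have "\<phi> j i z \<notin> {x, y}" using h_in[OF jit(1) z(2) iw[OF jit(2) z(2)]] unfolding \<phi>_def by simp
      then show ?thesis using z(1) by blast
    qed
    ultimately show ?thesis using W_n[OF jit(1)] unfolding B_def all_edges_altdef by blast
  qed
  have B_disj: "disjoint_family_on B {..<K}"
    unfolding disjoint_family_on_def
  proof (intro ballI impI)
    fix j j' assume j: "j \<in> {..<K}" "j' \<in> {..<K}" "j \<noteq> j'"
    have WW: "W j \<inter> W j' \<subseteq> {x, y}"
    proof
      fix v assume v: "v \<in> W j \<inter> W j'"
      show "v \<in> {x, y}"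
      proof (rule ccontr)
        assume "v \<notin> {x, y}"
        then obtain z c z' c' where "z \<in> S" "c < w" "v = h (j, z, c)" "z' \<in> S" "c' < w" "v = h (j', z', c')"
          using v unfolding W_def by auto
        then show False using h_inj[of j z c j' z' c'] j by simp
      qed
    qed
    have False if e: "e \<in> B j" "e \<in> B j'" for e
    proof -
      have "e \<subseteq> {x, y}" "card e = 2" "e \<noteq> {x, y}"
        using e WW unfolding B_def all_edges_altdef by auto
      then show False using x(3) card_subset_eq[of "{x, y}" e] by simp
    qed
    then show "B j \<inter> B j' = {}" by blast
  qed
  have BE: "B j \<subseteq> all_edges n" for j unfolding B_def by auto
  define D where "D j G \<longleftrightarrow> (\<forall>i\<in>I. \<not> (\<forall>t\<in>T. \<phi> j i ` t \<in> G))" for j G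
  let ?d = "\<Sum>A\<in>Pow S - {{}}. (1 / real w) ^ card A * (1 / p) ^ card (edges_in T ({a, b} \<union> A))"
  have D_bound: "bernoulli_exp p (B j) (\<lambda>G. of_bool (D j G)) \<le> ?d" if j: "j < K" for j
    unfolding D_def \<phi>_def I_def edges_in_def
  proof (rule rooted_embedding_second_moment[where h = "\<lambda>z c. h (j, z, c)" and S = S and T = T
        and E = "B j" and R = "{a, b}" and w = w and p = p and \<rho> = \<rho>])
    show "finite (B j)" by (rule finite_subset[OF BE]) simp
    show "S \<inter> {a, b} = {}" using S by auto
    show "t \<subseteq> {a, b} \<union> S" if "t \<in> T" for t using T2(1)[OF that] V_eq by simp
    show "inj_on (\<lambda>(z, c). h (j, z, c)) (S \<times> {..<w})"
    proof (rule inj_onI)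
      fix u v assume "u \<in> S \<times> {..<w}" "v \<in> S \<times> {..<w}" "(\<lambda>(z, c). h (j, z, c)) u = (\<lambda>(z, c). h (j, z, c)) v"
      then show "u = v" using h_inj[of j "fst u" "snd u" j "fst v" "snd v"] j
        by (auto simp: case_prod_beta prod_eq_iff)
    qed
    show "inj_on \<rho> {a, b}" using x V unfolding \<rho>_def inj_on_def by auto
    show "h (j, z, c) \<notin> \<rho> ` {a, b}" if "z \<in> S" "c < w" for z c
      using h_in[OF j that] \<rho>_im by simp
    show "(\<lambda>x. if x \<in> S then h (j, x, i x) else \<rho> x) ` t \<in> B j" if "i \<in> S \<rightarrow>\<^sub>E {..<w}" "t \<in> T" for i t
      using \<phi>_B[OF j _ that(2), of i] that(1) unfolding \<phi>_def I_def by simp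
  qed (use finS finT noR p w in auto)
  have "bernoulli_exp p (all_edges n) (\<lambda>G. of_bool ({x, y} \<notin> perc_closure n k EH G))
      \<le> bernoulli_exp p (all_edges n) (\<lambda>G. \<Prod>j\<in>{..<K}. of_bool (D j (G \<inter> B j)))"
  proof (rule bernoulli_exp_mono)
    fix G
    have "D j (G \<inter> B j)" if "{x, y} \<notin> perc_closure n k EH G" "j < K" for j
      unfolding D_def
    proof (intro ballI notI)
      fix i assume i: "i \<in> I" "\<forall>t\<in>T. \<phi> j i ` t \<in> G \<inter> B j"
      have "{\<phi> j i a, \<phi> j i b} \<in> perc_closure n k EH G"
      proof (rule act[OF \<phi>_inj[OF that(2) i(1)]])
        show "\<phi> j i ` V \<subseteq> {0..<n}" using \<phi>_W[OF i(1)] W_n[OF that(2)] by blast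
      qed (use i in blast)
      moreover have "\<phi> j i a = x" "\<phi> j i b = y" using S V unfolding \<phi>_def \<rho>_def by auto
      ultimately show False using that by simp
    qed
    then have "{x, y} \<notin> perc_closure n k EH G \<Longrightarrow> (\<Prod>j\<in>{..<K}. of_bool (D j (G \<inter> B j))) = (1::real)"
      by (intro prod.neutral) auto
    moreover have "0 \<le> (\<Prod>j\<in>{..<K}. of_bool (D j (G \<inter> B j)) :: real)" by (intro prod_nonneg) auto
    ultimately show "of_bool ({x, y} \<notin> perc_closure n k EH G) \<le> (\<Prod>j\<in>{..<K}. of_bool (D j (G \<inter> B j)) :: real)"
      by auto
  qed (use p in auto)
  also have "\<dots> = (\<Prod>j\<in>{..<K}. bernoulli_exp p (B j) (\<lambda>G. of_bool (D j G)))"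
    using BE B_disj by (intro bernoulli_exp_prod) auto
  also have "\<dots> \<le> (\<Prod>j\<in>{..<K}. ?d)"
    using D_bound p by (intro prod_mono conjI bernoulli_exp_nonneg) auto
  also have "\<dots> = ?d ^ K" by simp
  finally show ?thesis .
qed

lemma gnp_percolates:
  assumes bal: "balanced_graph k EH" and \<epsilon>: "0 < \<epsilon>" "\<epsilon> < 1 / lambda_H k EH"
  shows "eventually (\<lambda>n. gnp_prob n (real n powr (\<epsilon> - 1 / lambda_H k EH))
            (\<lambda>G. perc_closure n k EH G = all_edges n) \<ge> 1 / 2) sequentially"
proof -
  define l where "l = lambda_H k EH"
  define \<theta> where "\<theta> = 1 / l - \<epsilon>"
  \<comment> \<open>The slack: as \<theta> \<lambda> = 1 - c, each new vertex together with its
    \<lambda> edges gains a factor n^c.\<close>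
  define c where "c = \<epsilon> * l"
  have l: "1 \<le> l" "3 \<le> k" using bal unfolding balanced_graph_def l_def by auto
  have \<theta>: "0 < \<theta>" using \<epsilon> unfolding \<theta>_def l_def by simp
  have c: "0 < c" using \<epsilon> l unfolding c_def by simp
  have \<theta>l: "\<theta> * l = 1 - c" unfolding \<theta>_def c_def using l by (simp add: field_simps)
  \<comment> \<open>The full gadget costs a further factor n^\<theta> for its excess edge, and
    \<theta> < 1/\<lambda>. A chain of this length gains enough to pay for it and still keep
    n^c.\<close>
  obtain L :: nat where "(c + 1 / l) / c < real L" using reals_Archimedean2 by blast
  then have L: "c + 1 / l \<le> c * real L" using c by (simp add: field_simps)
  have L1: "1 \<le> L"
  proof (rule ccontr)
    assume "\<not> 1 \<le> L"
    then have "L = 0" by simp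
    then have "c + 1 / l \<le> 0" using L by simp
    moreover have "0 < 1 / l" using l by simp
    ultimately show False using c by linarith
  qed
  obtain V T a b where gad: "gadget k EH V T a b" and cV: "card V = L * (k - 2) + 2"
    using gadget_exists[OF bal] by blast
  define S where "S = V - {a, b}"
  define s where "s = card S"
  have V: "finite V" "a \<in> V" "b \<in> V" "a \<noteq> b" using gad unfolding gadget_def by auto
  have finS: "finite S" unfolding S_def using V by simp
  have s_eq: "s = L * (k - 2)" unfolding s_def S_def using V cV by (simp add: card_Diff_subset)
  have sL: "L \<le> s" unfolding s_eq using mult_le_mono2[of 1 "k - 2" L] l by linarith
  have s1: "1 \<le> s" using sL L1 by simp
  have Sne: "S \<noteq> {}" using s1 unfolding s_def by auto
  define e where "e A = card (edges_in T ({a, b} \<union> A))" for A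
  have expo: "\<theta> * real (e A) \<le> real (card A) - c" if A: "A \<subseteq> S" "A \<noteq> {}" for A
  proof (cases "A = S")
    case True
    have "{a, b} \<union> A = V" using True V unfolding S_def by auto
    moreover have "\<And>t. t \<in> T \<Longrightarrow> t \<subseteq> V" using gad unfolding gadget_def by auto
    ultimately have "edges_in T ({a, b} \<union> A) = T" unfolding edges_in_def by auto
    then have "real (e A) = l * (real (card V) - 2) + 1"
      using gad unfolding e_def gadget_def l_def by simp
    then have "\<theta> * real (e A) = \<theta> * l * real s + \<theta>"
      using cV s_eq by (simp add: algebra_simps)
    also have "\<dots> \<le> real s - c * real s + 1 / l" unfolding \<theta>l using \<epsilon> by (simp add: \<theta>_def algebra_simps)
    also have "\<dots> \<le> real s - c"
    proof -
      have "c * real L \<le> c * real s" using sL c by (intro mult_left_mono) auto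
      then show ?thesis using L by linarith
    qed
    finally show ?thesis using True s_def by simp
  next
    case False
    then have "{a, b} \<union> A \<subset> V" using A V unfolding S_def by auto
    then have "real (e A) \<le> l * real (card ({a, b} \<union> A - {a, b}))"
      using gad unfolding gadget_def e_def l_def by blast
    moreover have "{a, b} \<union> A - {a, b} = A" using A unfolding S_def by auto
    ultimately have "real (e A) \<le> l * real (card A)" by simp
    then have "\<theta> * real (e A) \<le> \<theta> * (l * real (card A))" using \<theta> by (intro mult_left_mono) auto
    also have "\<dots> = real (card A) - c * real (card A)" 
      unfolding mult.assoc[symmetric] \<theta>l by (simp add: left_diff_distrib)
    also have "\<dots> \<le> real (card A) - c"
    proof -
      have "card A > 0" using A finS by (simp add: card_gt_0_iff finite_subset)
      then have "1 \<le> real (card A)" by simp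
      then have "c * 1 \<le> c * real (card A)" using c by (intro mult_left_mono) auto
      then show ?thesis by simp
    qed
    finally show ?thesis .
  qed
  \<comment> \<open>One attempt fails with probability O(n^-c), and at most n^2 edges must be
    infected; c K \<ge> 3 leaves a total failure probability O(1/n).\<close>
  obtain K :: nat where "3 / c < real K" using reals_Archimedean2 by blast
  then have K: "3 \<le> c * real K" using c by (simp add: field_simps)
  then have K1: "1 \<le> K" by (cases K) auto
  \<comment> \<open>The class size \<open>w\<close> is roughly n / (K s); the factor 2 absorbs the
    two root vertices and the rounding once n \<ge> 4 + 2 K s.\<close>
  define M where "M = 2 * real K * real s"
  have M: "1 \<le> M" unfolding M_def using K1 s1 mult_mono[of 1 "real K" 1 "real s"] by simp
  \<comment> \<open>\<open>2 ^ s\<close> counts the agreement sets, and \<open>M ^ s\<close> bounds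
    (n / w)^|A| for each of them.\<close>
  define D where "D = 2 ^ s * M ^ s"
  have D: "0 \<le> D" unfolding D_def using M by simp
  have main: "gnp_prob n (real n powr - \<theta>) (\<lambda>G. perc_closure n k EH G = all_edges n)
      \<ge> 1 - D ^ K / real n" if n: "n \<ge> 4 + 2 * K * s" for n
  proof -
    define p where "p = real n powr - \<theta>"
    define w where "w = (n - 2) div (K * s)"
    have Ks: "0 < K * s" using K1 s1 by simp
    have w_le: "K * (card S * w) \<le> n - 2"
      unfolding w_def s_def[symmetric] mult.assoc[symmetric] by simp
    have n1: "1 \<le> real n" using n by simp
    have p: "0 < p" "p \<le> 1" unfolding p_def using n1 \<theta> powr_mono[of "- \<theta>" 0 "real n"] by auto
    have w_ge: "real n / M \<le> real w"
    proof -
      have "n - 2 < K * s * (w + 1)"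
        unfolding w_def using dividend_less_times_div[OF Ks, of "n - 2"] by (simp add: add.commute)
      then have "real (n - 2) \<le> real (K * s * (w + 1))" by linarith
      then have "real n - 2 \<le> real K * real s * (real w + 1)" using n by (simp add: algebra_simps)
      moreover have "real n \<ge> 4 + 2 * (real K * real s)" 
      proof -
        have "real (4 + 2 * K * s) \<le> real n" using n by (simp only: of_nat_le_iff)
        then show ?thesis by (simp add: mult.assoc)
      qed
      ultimately have "real n \<le> 2 * (real K * real s) * real w" by (simp add: algebra_simps)
      then have "real n \<le> M * real w" unfolding M_def by (simp add: mult.assoc)
      then show ?thesis using M by (simp add: pos_divide_le_eq mult.commute)
    qed
    have w0: "0 < w"
    proof -
      have "0 < real n / M" using n1 M by simp
      then show ?thesis using w_ge by linarith
    qed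
    define d where "d = (\<Sum>A\<in>Pow S - {{}}. (1 / real w) ^ card A * (1 / p) ^ e A)"
    have "d \<le> (\<Sum>A\<in>Pow S - {{}}. M ^ s * real n powr - c)"
      unfolding d_def
    proof (rule sum_mono)
      fix A assume A: "A \<in> Pow S - {{}}"
      then have cA: "card A \<le> s" unfolding s_def using finS by (simp add: card_mono)
      have "1 / real w \<le> M / real n" using w_ge w0 n1 M by (simp add: field_simps)
      then have "(1 / real w) ^ card A \<le> (M / real n) ^ card A" by (intro power_mono) auto
      also have "\<dots> = M ^ card A * real n powr - real (card A)"
        using n1 by (simp add: power_divide powr_minus powr_realpow field_simps)
      also have "\<dots> \<le> M ^ s * real n powr - real (card A)"
        using M cA by (intro mult_right_mono power_increasing) auto
      finally have 1: "(1 / real w) ^ card A \<le> M ^ s * real n powr - real (card A)" .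
      have "(1 / p) ^ e A = real n powr (\<theta> * real (e A))"
      proof -
        have "1 / p = real n powr \<theta>" unfolding p_def using n1 by (simp add: powr_minus_divide)
        then show ?thesis using n1 by (simp add: powr_power mult.commute)
      qed
      also have "\<dots> \<le> real n powr (real (card A) - c)"
        using expo[of A] A n1 by (intro powr_mono) auto
      finally have 2: "(1 / p) ^ e A \<le> real n powr (real (card A) - c)" .
      have "(1 / real w) ^ card A * (1 / p) ^ e A
          \<le> (M ^ s * real n powr - real (card A)) * real n powr (real (card A) - c)"
        using 1 2 M p by (intro mult_mono) auto
      also have "\<dots> = M ^ s * real n powr - c" by (simp add: powr_add[symmetric])
      finally show "(1 / real w) ^ card A * (1 / p) ^ e A \<le> M ^ s * real n powr - c" .
    qed
    also have "\<dots> = real (card (Pow S - {{}})) * (M ^ s * real n powr - c)" by simp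
    also have "\<dots> \<le> 2 ^ s * (M ^ s * real n powr - c)"
    proof (rule mult_right_mono)
      have "card (Pow S - {{}}) \<le> card (Pow S)" using finS by (intro card_mono) auto
      then have "card (Pow S - {{}}) \<le> 2 ^ s" unfolding s_def using finS by (simp add: card_Pow)
      then show "real (card (Pow S - {{}})) \<le> 2 ^ s" by (metis of_nat_le_iff of_nat_numeral of_nat_power)
    qed (use M in auto)
    also have "\<dots> = D * real n powr - c" unfolding D_def by simp
    finally have d: "d \<le> D * real n powr - c" .
    have d0: "0 \<le> d" unfolding d_def using p by (intro sum_nonneg) auto
    have edge: "bernoulli_exp p (all_edges n) (\<lambda>G. of_bool (f \<notin> perc_closure n k EH G)) \<le> d ^ K"
      if f: "f \<in> all_edges n" for f
    proof -
      obtain x y where "x < n" "y < n" "x \<noteq> y" "f = {x, y}" using f unfolding all_edges_def by blast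
      then show ?thesis
        using edge_not_infected_bound[OF gad _ _ _ p S_def Sne w0 w_le] unfolding d_def e_def by blast
    qed
    have "1 = bernoulli_exp p (all_edges n) (\<lambda>_. 1)" by (simp add: bernoulli_exp_one)
    also have "\<dots> \<le> bernoulli_exp p (all_edges n) (\<lambda>G. of_bool (perc_closure n k EH G = all_edges n)
        + (\<Sum>f\<in>all_edges n. of_bool (f \<notin> perc_closure n k EH G)))"
    proof (rule bernoulli_exp_mono)
      fix G assume G: "G \<subseteq> all_edges n"
      show "1 \<le> of_bool (perc_closure n k EH G = all_edges n)
        + (\<Sum>f\<in>all_edges n. of_bool (f \<notin> perc_closure n k EH G) :: real)"
      proof (cases "perc_closure n k EH G = all_edges n")
        case False
        then obtain f where f: "f \<in> all_edges n" "f \<notin> perc_closure n k EH G"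
          using perc_closure_subset[OF G] by blast
        then have "of_bool (f \<notin> perc_closure n k EH G) \<le> (\<Sum>f\<in>all_edges n. of_bool (f \<notin> perc_closure n k EH G) :: real)"
          by (intro member_le_sum) auto
        then show ?thesis using f by simp
      qed (simp add: sum_nonneg)
    qed (use p in auto)
    also have "\<dots> = gnp_prob n p (\<lambda>G. perc_closure n k EH G = all_edges n)
        + (\<Sum>f\<in>all_edges n. bernoulli_exp p (all_edges n) (\<lambda>G. of_bool (f \<notin> perc_closure n k EH G)))"
      by (simp only: bernoulli_exp_add bernoulli_exp_sum gnp_prob_eq)
    finally have total: "1 \<le> gnp_prob n p (\<lambda>G. perc_closure n k EH G = all_edges n)
        + (\<Sum>f\<in>all_edges n. bernoulli_exp p (all_edges n) (\<lambda>G. of_bool (f \<notin> perc_closure n k EH G)))" .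
    have "(\<Sum>f\<in>all_edges n. bernoulli_exp p (all_edges n) (\<lambda>G. of_bool (f \<notin> perc_closure n k EH G)))
        \<le> (\<Sum>f\<in>all_edges n. d ^ K)"
      using edge by (intro sum_mono) auto
    also have "\<dots> = real (card (all_edges n)) * d ^ K" by simp
    also have "\<dots> \<le> real n ^ 2 * (D * real n powr - c) ^ K"
    proof (intro mult_mono power_mono)
      have "all_edges n \<subseteq> (\<lambda>(u, v). {u, v}) ` ({0..<n} \<times> {0..<n})"
        unfolding all_edges_def by auto
      then have "card (all_edges n) \<le> card ({0..<n} \<times> {0..<n})"
        by (intro surj_card_le) auto
      then have "card (all_edges n) \<le> n ^ 2" by (simp add: power2_eq_square)
      then show "real (card (all_edges n)) \<le> real n ^ 2" by (metis of_nat_le_iff of_nat_power)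
    qed (use d d0 in auto)
    also have "\<dots> = D ^ K * real n powr (2 - c * real K)"
    proof -
      have "(real n powr - c) ^ K = real n powr (- c * real K)" using n1 by (simp add: powr_power mult.commute)
      moreover have "real n ^ 2 = real n powr 2" using n1 by simp
      ultimately have "real n ^ 2 * (real n powr - c) ^ K = real n powr (2 - c * real K)"
        using powr_add[of "real n" 2 "- c * real K"] by simp
      then show ?thesis by (simp add: power_mult_distrib)
    qed
    also have "\<dots> \<le> D ^ K * real n powr - 1"
      using K n1 D by (intro mult_left_mono powr_mono) auto
    also have "\<dots> = D ^ K / real n" using n1 by (simp add: powr_minus field_simps)
    finally show ?thesis using total unfolding p_def by linarith
  qed
  have "((\<lambda>n. 1 - D ^ K / real n) \<longlongrightarrow> 1) sequentially" by real_asymp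
  then have "eventually (\<lambda>n. 1 - D ^ K / real n > 1 / 2) sequentially"
    by (rule order_tendstoD) simp
  then show ?thesis
    using eventually_ge_at_top[of "4 + 2 * K * s"]
  proof eventually_elim
    case (elim n)
    have "\<epsilon> - 1 / lambda_H k EH = - \<theta>" unfolding \<theta>_def l_def by simp
    then show ?case using main[OF elim(2)] elim(1) by simp
  qed
qed

section \<open>Lower bound on the threshold\<close>

text \<open>\<open>E\<close> is the set of edges owned by \<open>S\<close>, possibly fewer than
  \<open>G\<close> has inside \<open>S\<close>: the vertex sets of clusters may overlap, and
  ownership prevents an edge from being counted twice.\<close>

definition dense_in :: "nat set set \<Rightarrow> real \<Rightarrow> nat set \<Rightarrow> nat set set \<Rightarrow> bool" where
  "dense_in G l S E \<longleftrightarrow> E \<subseteq> edges_in G S \<and> l * (real (card S) - 2) + 1 \<le> real (card E)"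

text \<open>Ownership must be disjoint, but an edge counts as covered as soon as it lies inside some
  vertex set. Infected edges outside \<open>G\<close> are thus covered without being owned.\<close>

definition cluster_cover :: "nat \<Rightarrow> real \<Rightarrow> nat \<Rightarrow> nat set set \<Rightarrow> (nat set \<times> nat set set) set \<Rightarrow> bool" where
  "cluster_cover n l M G C \<longleftrightarrow> finite C \<and>
     (\<forall>c\<in>C. fst c \<subseteq> {0..<n} \<and> card (fst c) \<le> M \<and> dense_in G l (fst c) (snd c)) \<and>
     (\<forall>c\<in>C. \<forall>d\<in>C. c \<noteq> d \<longrightarrow> snd c \<inter> snd d = {}) \<and>
     (\<forall>e\<in>G. \<exists>c\<in>C. e \<subseteq> fst c)"

lemma cluster_cover_merge:
  assumes bal: "balanced_graph k EH" and l_def: "l = lambda_H k EH"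
    and C: "cluster_cover n l M G C" and G: "G \<subseteq> all_edges n"
    and f: "inj_on f {0..<k}" "f ` {0..<k} \<subseteq> {0..<n}" and x0: "x0 \<in> EH"
    and copy: "\<And>x. x \<in> EH \<Longrightarrow> x \<noteq> x0 \<Longrightarrow> \<exists>c\<in>C. f ` x \<subseteq> fst c"
    and new: "\<And>c. c \<in> C \<Longrightarrow> \<not> f ` x0 \<subseteq> fst c"
    and gap: "\<And>S E. S \<subseteq> {0..<n} \<Longrightarrow> M < card S \<Longrightarrow> card S \<le> k + card EH * M \<Longrightarrow> \<not> dense_in G l S E"
  shows "\<exists>C'. cluster_cover n l M G C' \<and> card C' < card C"
proof -
  have H: "finite EH" "3 \<le> card EH" "1 \<le> l" "EH \<subseteq> all_edges k" "3 \<le> k"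
    using bal balanced_graph_edges[OF bal] unfolding balanced_graph_def l_def by auto
  have finC: "finite C" and Cn: "\<And>c. c \<in> C \<Longrightarrow> fst c \<subseteq> {0..<n}" and CM: "\<And>c. c \<in> C \<Longrightarrow> card (fst c) \<le> M"
    and Cd: "\<And>c. c \<in> C \<Longrightarrow> dense_in G l (fst c) (snd c)"
    and Cdisj: "\<And>c d. c \<in> C \<Longrightarrow> d \<in> C \<Longrightarrow> c \<noteq> d \<Longrightarrow> snd c \<inter> snd d = {}"
    and Ccov: "\<And>e. e \<in> G \<Longrightarrow> \<exists>c\<in>C. e \<subseteq> fst c"
    using C unfolding cluster_cover_def by blast+
  have finG: "finite G" using G finite_subset by fastforce
  have "\<forall>x\<in>EH - {x0}. \<exists>c\<in>C. f ` x \<subseteq> fst c" using copy by blast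
  \<comment> \<open>One cluster is selected per edge, so the shares partition the edges of H other
    than \<open>x0\<close>.\<close>
  then obtain ch where ch: "\<And>x. x \<in> EH - {x0} \<Longrightarrow> ch x \<in> C \<and> f ` x \<subseteq> fst (ch x)"
    by metis
  define U where "U = ch ` (EH - {x0})"
  have finU: "finite U" unfolding U_def using H by simp
  have UC: "U \<subseteq> C" unfolding U_def using ch by blast
  define V where "V = f ` {0..<k}"
  have cV: "card V = k" unfolding V_def using f(1) by (simp add: card_image)
  define F where "F c = {i \<in> {0..<k}. f i \<in> fst c}" for c :: "nat set \<times> nat set set"
  have cF: "card (F c) = card (fst c \<inter> V)" for c
  proof -
    have "f ` F c = fst c \<inter> V" unfolding F_def V_def by auto
    moreover have "inj_on f (F c)" using f(1) unfolding F_def by (rule inj_on_subset) auto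
    ultimately show ?thesis by (metis card_image)
  qed
  have finc: "finite (fst c)" if "c \<in> U" for c
    using that UC Cn[of c] finite_subset[of "fst c" "{0..<n}"] by auto
  have edge: "x \<subseteq> {0..<k}" "card x = 2" if "x \<in> EH" for x using that H(4) unfolding all_edges_altdef by auto
  have share: "real (card {x \<in> EH - {x0}. ch x = c}) \<le> l * (real (card (F c)) - 2) + 1"
    and F2: "F c \<subset> {0..<k}" if c: "c \<in> U" for c
  proof -
    obtain x where x: "x \<in> EH - {x0}" "ch x = c" using c unfolding U_def by auto
    have sub: "y \<subseteq> F c" if "y \<in> EH - {x0}" "ch y = c" for y
      using ch[OF that(1)] that edge(1)[of y] unfolding F_def by auto
    have finF: "finite (F c)" unfolding F_def by simp
    have "card x \<le> card (F c)" using sub[OF x] finF by (intro card_mono) auto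
    then have 2: "2 \<le> card (F c)" using edge(2)[of x] x by simp
    show ps: "F c \<subset> {0..<k}"
    proof -
      have "F c \<noteq> {0..<k}"
      proof
        assume "F c = {0..<k}"
        then have "f ` x0 \<subseteq> fst c" using edge(1)[OF x0] unfolding F_def by blast
        then show False using new c UC by blast
      qed
      then show ?thesis unfolding F_def by blast
    qed
    have "card {x \<in> EH - {x0}. ch x = c} \<le> card (edges_in EH (F c))"
    proof (rule card_mono)
      show "{x \<in> EH - {x0}. ch x = c} \<subseteq> edges_in EH (F c)"
        using sub unfolding edges_in_def by blast
    qed (use H in \<open>simp add: edges_in_def\<close>)
    moreover have "real (card (edges_in EH (F c))) \<le> l * (real (card (F c)) - 2) + 1"
      using bal ps 2 unfolding balanced_graph_def l_def by blast
    ultimately show "real (card {x \<in> EH - {x0}. ch x = c}) \<le> l * (real (card (F c)) - 2) + 1"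
      by linarith
  qed
  have shares: "l * (real k - 2) + 1 \<le> (\<Sum>c\<in>U. l * (real (card (F c)) - 2) + 1)"
  proof -
    have "card (EH - {x0}) = (\<Sum>c\<in>U. card {x \<in> EH - {x0}. ch x = c})"
      using sum.group[of "EH - {x0}" U ch "\<lambda>_. 1::nat"] finU H unfolding U_def by simp
    then have "real (card EH) - 1 = (\<Sum>c\<in>U. real (card {x \<in> EH - {x0}. ch x = c}))"
      using x0 H by (simp flip: of_nat_sum)
    also have "\<dots> \<le> (\<Sum>c\<in>U. l * (real (card (F c)) - 2) + 1)" by (intro sum_mono share)
    finally show ?thesis using lambda_H_mult[of k EH] H unfolding l_def by simp
  qed
  \<comment> \<open>A single cluster would meet the copy in fewer than \<open>k\<close> vertices,
    and its share would be too small. At least two clusters are replaced by one, so their number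
    drops.\<close>
  have U2: "2 \<le> card U"
  proof (rule ccontr)
    assume "\<not> 2 \<le> card U"
    then have "card U = 0 \<or> card U = 1" by linarith
    moreover have "card U \<noteq> 0"
    proof -
      have "card (EH - {x0}) \<noteq> 0" using H x0 by simp
      then have "EH - {x0} \<noteq> {}" by force
      then show ?thesis using finU unfolding U_def by simp
    qed
    ultimately obtain c where c: "U = {c}" by (metis card_1_singletonE)
    have "card (F c) < k" using psubset_card_mono[OF _ F2[of c]] c by simp
    then have "l * (real (card (F c)) - 2) < l * (real k - 2)" using H by simp
    then show False using shares c by simp
  qed
  \<comment> \<open>The copy is included explicitly: a vertex of H on no edge other than
    \<open>x0\<close> may lie in none of the selected clusters.\<close>
  define S where "S = V \<union> (\<Union>c\<in>U. fst c)"
  define E where "E = (\<Union>c\<in>U. snd c)"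
  have Sn: "S \<subseteq> {0..<n}" unfolding S_def V_def using f(2) Cn UC by blast
  have finV: "finite V" unfolding V_def by simp
  have split_card: "card (fst c) = card (F c) + card (fst c - V)" if "c \<in> U" for c
  proof -
    have "card (fst c) = card (fst c \<inter> V) + card (fst c - V)"
      using finc[OF that] by (metis Int_Diff_Un Int_Diff_disjoint card_Un_disjoint finite_Diff finite_Int)
    then show ?thesis using cF by simp
  qed
  have cS: "card S \<le> k + (\<Sum>c\<in>U. card (fst c - V))"
  proof -
    have "S = V \<union> (\<Union>c\<in>U. fst c - V)" unfolding S_def by blast
    then have "card S \<le> card V + card (\<Union>c\<in>U. fst c - V)" by (metis card_Un_le)
    also have "card (\<Union>c\<in>U. fst c - V) \<le> (\<Sum>c\<in>U. card (fst c - V))"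
      using finU by (rule card_UN_le)
    finally show ?thesis using cV by simp
  qed
  have dense: "dense_in G l S E"
    unfolding dense_in_def
  proof
    show "E \<subseteq> edges_in G S"
      using Cd UC unfolding E_def S_def dense_in_def edges_in_def by blast
    have fin_snd: "finite (snd c)" if "c \<in> U" for c
    proof -
      have "snd c \<subseteq> G" using Cd[of c] that UC unfolding dense_in_def edges_in_def by blast
      then show ?thesis using finG finite_subset by blast
    qed
    have "card E = (\<Sum>c\<in>U. card (snd c))"
      unfolding E_def using finU fin_snd Cdisj UC by (intro card_UN_disjoint) blast+
    then have "real (card E) = (\<Sum>c\<in>U. real (card (snd c)))" by simp
    also have "\<dots> \<ge> (\<Sum>c\<in>U. l * (real (card (fst c)) - 2) + 1)"
      using Cd UC unfolding dense_in_def by (intro sum_mono) blast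
    finally have 1: "(\<Sum>c\<in>U. l * (real (card (fst c)) - 2) + 1) \<le> real (card E)" .
    have "(\<Sum>c\<in>U. l * (real (card (fst c)) - 2) + 1)
        = (\<Sum>c\<in>U. (l * (real (card (F c)) - 2) + 1) + l * real (card (fst c - V)))"
      using split_card by (intro sum.cong refl) (simp add: algebra_simps)
    also have "\<dots> = (\<Sum>c\<in>U. l * (real (card (F c)) - 2) + 1) + l * real (\<Sum>c\<in>U. card (fst c - V))"
      by (subst sum.distrib) (simp add: sum_distrib_left)
    finally have 2: "(\<Sum>c\<in>U. l * (real (card (fst c)) - 2) + 1)
      = (\<Sum>c\<in>U. l * (real (card (F c)) - 2) + 1) + l * real (\<Sum>c\<in>U. card (fst c - V))" .
    have "real (card S) \<le> real k + real (\<Sum>c\<in>U. card (fst c - V))"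
      using cS by (simp only: of_nat_add[symmetric] of_nat_le_iff)
    then have "l * (real (card S) - 2) \<le> l * ((real k - 2) + real (\<Sum>c\<in>U. card (fst c - V)))"
      using H by (intro mult_left_mono) auto
    then have "l * (real (card S) - 2) \<le> l * (real k - 2) + l * real (\<Sum>c\<in>U. card (fst c - V))"
      by (simp only: distrib_left)
    then show "l * (real (card S) - 2) + 1 \<le> real (card E)" using 1 2 shares by linarith
  qed
  have "card S \<le> k + card EH * M"
  proof -
    have "(\<Sum>c\<in>U. card (fst c - V)) \<le> (\<Sum>c\<in>U. M)"
    proof (rule sum_mono)
      fix c assume c: "c \<in> U"
      have "card (fst c - V) \<le> card (fst c)" using finc[OF c] by (intro card_mono) auto
      then show "card (fst c - V) \<le> M" using CM[of c] c UC by auto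
    qed
    also have "\<dots> = card U * M" by simp
    also have "\<dots> \<le> card EH * M"
    proof (rule mult_le_mono1)
      have "card U \<le> card (EH - {x0})" unfolding U_def using H by (intro card_image_le) auto
      then show "card U \<le> card EH" using H x0 by simp
    qed
    finally show ?thesis using cS by linarith
  qed
  with gap[OF Sn, of E] dense have SM: "card S \<le> M" by (metis not_le)
  define C' where "C' = (C - U) \<union> {(S, E)}"
  have "card C' < card C"
  proof -
    have "card C' \<le> card (C - U) + 1" unfolding C'_def using card_Un_le[of "C - U" "{(S, E)}"] by simp
    moreover have "card (C - U) = card C - card U" using finU UC by (rule card_Diff_subset)
    moreover have "card U \<le> card C" using finC UC by (rule card_mono)
    ultimately show ?thesis using U2 by linarith
  qed
  moreover have "cluster_cover n l M G C'"
    unfolding cluster_cover_def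
  proof (intro conjI ballI impI)
    show "finite C'" unfolding C'_def using finC by simp
  next
    fix c assume "c \<in> C'"
    then consider "c \<in> C" | "c = (S, E)" unfolding C'_def by blast
    then show "fst c \<subseteq> {0..<n}" "card (fst c) \<le> M" "dense_in G l (fst c) (snd c)"
      using Cn CM Cd Sn SM dense by (cases; simp)+
  next
    have SE: "snd c \<inter> E = {}" if "c \<in> C - U" for c
      unfolding E_def using Cdisj that UC by blast
    fix c d assume cd: "c \<in> C'" "d \<in> C'" "c \<noteq> d"
    then consider "c \<in> C - U" "d \<in> C - U" | "c \<in> C - U" "d = (S, E)" | "c = (S, E)" "d \<in> C - U"
      unfolding C'_def by blast
    then show "snd c \<inter> snd d = {}"
    proof cases
      case 1
      then show ?thesis using Cdisj[of c d] cd(3) by blast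
    next
      case 2
      then show ?thesis using SE[of c] by simp
    next
      case 3
      then show ?thesis using SE[of d] by auto
    qed
  next
    fix e assume "e \<in> G"
    then obtain c where c: "c \<in> C" "e \<subseteq> fst c" using Ccov by blast
    show "\<exists>c\<in>C'. e \<subseteq> fst c"
    proof (cases "c \<in> U")
      case True
      then have "e \<subseteq> fst (S, E)" using c unfolding S_def by auto
      then show ?thesis unfolding C'_def by blast
    next
      case False
      then show ?thesis using c unfolding C'_def by blast
    qed
  qed
  ultimately show ?thesis by blast
qed

text \<open>A cover with the fewest clusters takes the place of a merging process: if a copy forced
  an uncovered edge, a merge would give a smaller cover. The edges inside clusters hence form a
  closed set containing the closure.\<close>

lemma perc_closure_dense:
  assumes bal: "balanced_graph k EH" and l_def: "l = lambda_H k EH" and G: "G \<subseteq> all_edges n" and M: "2 \<le> M"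
    and gap: "\<And>S E. S \<subseteq> {0..<n} \<Longrightarrow> M < card S \<Longrightarrow> card S \<le> k + card EH * M \<Longrightarrow> \<not> dense_in G l S E"
    and e: "e \<in> perc_closure n k EH G"
  shows "\<exists>S E. S \<subseteq> {0..<n} \<and> e \<subseteq> S \<and> card S \<le> M \<and> dense_in G l S E"
proof -
  have finG: "finite G" using G finite_subset by fastforce
  have "cluster_cover n l M G ((\<lambda>e. (e, {e})) ` G)"
  proof -
    have "dense_in G l e {e}" "e \<subseteq> {0..<n}" "card e = 2" if "e \<in> G" for e
      using that G unfolding dense_in_def edges_in_def all_edges_altdef by auto
    then show ?thesis using finG M unfolding cluster_cover_def by (auto 0 3)
  qed
  then obtain C where C: "cluster_cover n l M G C"
    and least: "\<And>C'. cluster_cover n l M G C' \<Longrightarrow> card C \<le> card C'"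
    using ex_has_least_nat[of "cluster_cover n l M G" "(\<lambda>e. (e, {e})) ` G" card] by blast
  define X where "X = {e \<in> all_edges n. \<exists>c\<in>C. e \<subseteq> fst c}"
  have "perc_closure n k EH G \<subseteq> X"
  proof (rule perc_closure_least)
    show "G \<subseteq> X" using C G unfolding X_def cluster_cover_def by blast
    fix e assume e: "e \<in> all_edges n" "has_copy_containing n k EH (X \<union> {e}) e"
    show "e \<in> X"
    proof (rule ccontr)
      assume eX: "e \<notin> X"
      from e(2) obtain f x0 where f: "inj_on f {0..<k}" "f ` {0..<k} \<subseteq> {0..<n}"
        "\<forall>x\<in>EH. f ` x \<in> X \<union> {e}" and x0: "x0 \<in> EH" "e = f ` x0"
        unfolding has_copy_containing_def by blast
      have inj: "x = x0" if "x \<in> EH" "f ` x = f ` x0" for x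
      proof -
        have "x \<subseteq> {0..<k}" "x0 \<subseteq> {0..<k}"
          using that x0 bal unfolding balanced_graph_def all_edges_altdef by auto
        then show ?thesis using inj_on_image_eq_iff[OF f(1)] that(2) by blast
      qed
      have "\<exists>C'. cluster_cover n l M G C' \<and> card C' < card C"
      proof (rule cluster_cover_merge[OF bal l_def C G f(1,2) x0(1)])
        show "\<exists>c\<in>C. f ` x \<subseteq> fst c" if "x \<in> EH" "x \<noteq> x0" for x
        proof -
          have "f ` x \<noteq> e" using inj[OF that(1)] that(2) x0(2) by auto
          then have "f ` x \<in> X" using f(3) that(1) by auto
          then show ?thesis unfolding X_def by blast
        qed
        show "\<not> f ` x0 \<subseteq> fst c" if "c \<in> C" for c
          using eX e(1) that x0(2) unfolding X_def by blast
      qed (rule gap)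
      then obtain C' where "cluster_cover n l M G C'" "card C' < card C" by blast
      then show False using least[of C'] by simp
    qed
  qed
  then obtain c where c: "c \<in> C" "e \<subseteq> fst c" using e unfolding X_def by blast
  then have "fst c \<subseteq> {0..<n}" "card (fst c) \<le> M" "dense_in G l (fst c) (snd c)"
    using C unfolding cluster_cover_def by auto
  then show ?thesis using c(2) by blast
qed

section \<open>First moment bounds for dense sets\<close>

lemma card_subsets_le: "finite A \<Longrightarrow> card {B. B \<subseteq> A \<and> card B = s} \<le> card A ^ s"
proof -
  assume "finite A"
  then have "card {B. B \<subseteq> A \<and> card B = s} = card A choose s" by (rule n_subsets)
  also have "\<dots> \<le> card A ^ s"
    using binomial_le_pow[of s "card A"] by (cases "s \<le> card A") (auto simp: binomial_eq_0)
  finally show ?thesis .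
qed

text \<open>Union bound over the possible owned edge sets. It is applied only to \<open>S\<close> of
  bounded size, so any factor depending on \<open>card S\<close> alone, such as the number of
  families of subsets of \<open>S\<close>, is harmless.\<close>

lemma dense_set_prob:
  assumes p: "0 < p" "p \<le> 1" and S: "S \<subseteq> {0..<n}"
  shows "bernoulli_exp p (all_edges n) (\<lambda>G. of_bool (\<exists>E. dense_in G l S E))
    \<le> 2 ^ (2 ^ card S) * p powr (l * (real (card S) - 2) + 1)"
proof -
  let ?m = "l * (real (card S) - 2) + 1"
  define Q where "Q = {E. E \<subseteq> edges_in (all_edges n) S \<and> ?m \<le> real (card E)}"
  have finS: "finite S" using S finite_subset by blast
  have QP: "Q \<subseteq> Pow (Pow S)" unfolding Q_def edges_in_def by blast
  have finQ: "finite Q" using QP finS by (meson finite_Pow_iff finite_subset)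
  have cQ: "card Q \<le> 2 ^ (2 ^ card S)"
    using card_mono[OF _ QP] finS by (simp add: card_Pow)
  have "bernoulli_exp p (all_edges n) (\<lambda>G. of_bool (\<exists>E. dense_in G l S E))
      \<le> bernoulli_exp p (all_edges n) (\<lambda>G. \<Sum>E\<in>Q. of_bool (E \<subseteq> G))"
  proof (rule bernoulli_exp_mono)
    fix G assume G: "G \<subseteq> all_edges n"
    show "of_bool (\<exists>E. dense_in G l S E) \<le> (\<Sum>E\<in>Q. of_bool (E \<subseteq> G) :: real)"
    proof (cases "\<exists>E. dense_in G l S E")
      case True
      then obtain E where E: "dense_in G l S E" by blast
      then have "E \<in> Q" "E \<subseteq> G" using G unfolding Q_def dense_in_def edges_in_def by auto
      then have "of_bool (E \<subseteq> G) \<le> (\<Sum>E\<in>Q. of_bool (E \<subseteq> G) :: real)"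
        using finQ by (intro member_le_sum) auto
      then show ?thesis using True \<open>E \<subseteq> G\<close> by simp
    qed (auto intro!: sum_nonneg)
  qed (use p in auto)
  also have "\<dots> = (\<Sum>E\<in>Q. p ^ card E)"
    unfolding bernoulli_exp_sum
    by (intro sum.cong refl bernoulli_exp_supset) (auto simp: Q_def edges_in_def)
  also have "\<dots> \<le> (\<Sum>E\<in>Q. p powr ?m)"
  proof (rule sum_mono)
    fix E assume "E \<in> Q"
    then have "?m \<le> real (card E)" unfolding Q_def by simp
    then have "p powr real (card E) \<le> p powr ?m" using p by (intro powr_mono') auto
    then show "p ^ card E \<le> p powr ?m" using p by (simp add: powr_realpow)
  qed
  also have "\<dots> = real (card Q) * p powr ?m" by simp
  also have "\<dots> \<le> 2 ^ (2 ^ card S) * p powr ?m"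
  proof (rule mult_right_mono)
    have "real (card Q) \<le> real (2 ^ (2 ^ card S))" using cQ by (simp only: of_nat_le_iff)
    then show "real (card Q) \<le> 2 ^ (2 ^ card S)" by simp
  qed simp
  finally show ?thesis .
qed

lemma sum_by_card:
  fixes g :: "nat \<Rightarrow> real"
  assumes "finite Q" "finite I" "\<And>S. S \<in> Q \<Longrightarrow> card S \<in> I"
    and "\<And>s. s \<in> I \<Longrightarrow> real (card {S \<in> Q. card S = s}) * g s \<le> b s"
  shows "(\<Sum>S\<in>Q. g (card S)) \<le> (\<Sum>s\<in>I. b s)"
proof -
  have "(\<Sum>S\<in>Q. g (card S)) = (\<Sum>s\<in>I. \<Sum>S\<in>{S \<in> Q. card S = s}. g (card S))"
    using assms by (intro sum.group[symmetric]) auto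
  also have "\<dots> = (\<Sum>s\<in>I. real (card {S \<in> Q. card S = s}) * g s)"
    by (intro sum.cong refl) simp
  also have "\<dots> \<le> (\<Sum>s\<in>I. b s)" by (intro sum_mono assms)
  finally show ?thesis .
qed

text \<open>Percolation infects \<open>{0, 1}\<close> in particular, so this edge lies in a small
  dense set or a dense set in the window exists. The bound is uniform in \<open>p\<close> below the
  threshold, as needed for a lower bound on an infimum.\<close>

lemma gnp_not_percolates:
  assumes bal: "balanced_graph k EH" and \<epsilon>: "0 < \<epsilon>"
  shows "eventually (\<lambda>n. \<forall>p. 0 < p \<longrightarrow> p \<le> real n powr (- \<epsilon> - 1 / lambda_H k EH) \<longrightarrow>
            gnp_prob n p (\<lambda>G. perc_closure n k EH G = all_edges n) < 1 / 2) sequentially"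
proof -
  define l where "l = lambda_H k EH"
  have l: "1 \<le> l" using bal unfolding balanced_graph_def l_def by auto
  \<comment> \<open>For sets of size s, the n^s choices and the probability combine to an exponent
    below 2 - \<epsilon> \<lambda> (s - 2). Sizes above \<open>M\<close> make the subtracted term at
    least 3, which gives n^-1.\<close>
  obtain M0 :: nat where M0: "3 / (\<epsilon> * l) < real M0" using reals_Archimedean2 by blast
  define M where "M = M0 + 2"
  define M' where "M' = k + card EH * M"
  have large: "3 \<le> \<epsilon> * l * (real s - 2)" if "M < s" for s
  proof -
    have pos: "0 < \<epsilon> * l" using \<epsilon> l by simp
    have "real M0 \<le> real s - 2" using that unfolding M_def by linarith
    then have "3 / (\<epsilon> * l) \<le> real s - 2" using M0 by linarith
    then show ?thesis using pos by (simp add: pos_divide_le_eq mult.commute)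
  qed
  define D where "D = (\<Sum>s\<in>{..M'}. 2 ^ (2 ^ s) :: real)"
  define D2 where "D2 = (\<Sum>s\<in>{2..M}. 2 ^ (2 ^ s) :: real)"
  have main: "gnp_prob n p (\<lambda>G. perc_closure n k EH G = all_edges n) \<le> D * real n powr - 1 + D2 * real n powr - \<epsilon>"
    if n: "2 \<le> n" and p: "0 < p" "p \<le> real n powr (- \<epsilon> - 1 / l)" for n p
  proof -
    have n1: "1 \<le> real n" using n by simp
    have "0 < 1 / l" using l by simp
    then have "real n powr (- \<epsilon> - 1 / l) \<le> real n powr 0"
      using n1 \<epsilon> by (intro powr_mono) linarith+
    then have p1: "p \<le> 1" using p n by simp
    define g where "g s = 2 ^ (2 ^ s) * p powr (l * (real s - 2) + 1)" for s :: nat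
    have g0: "0 \<le> g s" for s unfolding g_def by simp
    have g: "g s \<le> 2 ^ (2 ^ s) * real n powr (- (real s - 2) - \<epsilon> * l * (real s - 2) - \<epsilon>)" if "2 \<le> s" for s
      unfolding g_def
    proof (rule mult_left_mono)
      have m: "0 \<le> l * (real s - 2) + 1" using l that by simp
      have "p powr (l * (real s - 2) + 1) \<le> (real n powr (- \<epsilon> - 1 / l)) powr (l * (real s - 2) + 1)"
        using p m by (intro powr_mono2) auto
      also have "\<dots> = real n powr ((- \<epsilon> - 1 / l) * (l * (real s - 2) + 1))" by (simp add: powr_powr)
      also have "\<dots> \<le> real n powr (- (real s - 2) - \<epsilon> * l * (real s - 2) - \<epsilon>)"
      proof (rule powr_mono)
        have "(- \<epsilon> - 1 / l) * (l * (real s - 2) + 1) = - (real s - 2) - \<epsilon> * l * (real s - 2) - \<epsilon> - 1 / l"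
          using l by (simp add: field_simps)
        moreover have "0 < 1 / l" using l by simp
        ultimately show "(- \<epsilon> - 1 / l) * (l * (real s - 2) + 1) \<le> - (real s - 2) - \<epsilon> * l * (real s - 2) - \<epsilon>"
          by linarith
      qed (use n1 in simp)
      finally show "p powr (l * (real s - 2) + 1) \<le> real n powr (- (real s - 2) - \<epsilon> * l * (real s - 2) - \<epsilon>)" .
    qed simp
    define Q1 where "Q1 = {S. S \<subseteq> {0..<n} \<and> M < card S \<and> card S \<le> M'}"
    define Q2 where "Q2 = {S. S \<subseteq> {0..<n} \<and> {0, 1} \<subseteq> S \<and> card S \<le> M}"
    have fin: "finite Q1" "finite Q2"
      unfolding Q1_def Q2_def by (auto intro: finite_subset[of _ "Pow {0..<n}"])
    have Q_prob: "bernoulli_exp p (all_edges n) (\<lambda>G. of_bool (\<exists>E. dense_in G l S E)) \<le> g (card S)"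
      if "S \<in> Q1 \<union> Q2" for S
      unfolding g_def using that by (intro dense_set_prob p p1) (auto simp: Q1_def Q2_def)
    have s1: "(\<Sum>S\<in>Q1. g (card S)) \<le> (\<Sum>s\<in>{..M'}. 2 ^ (2 ^ s) * real n powr - 1)"
    proof (rule sum_by_card)
      fix s assume "s \<in> {..M'}"
      show "real (card {S \<in> Q1. card S = s}) * g s \<le> 2 ^ (2 ^ s) * real n powr - 1"
      proof (cases "M < s")
        case True
        have "card {S \<in> Q1. card S = s} \<le> card {S. S \<subseteq> {0..<n} \<and> card S = s}"
          by (intro card_mono) (auto simp: Q1_def intro: finite_subset[of _ "Pow {0..<n}"])
        also have "\<dots> \<le> n ^ s" using card_subsets_le[of "{0..<n}" s] by simp
        finally have "real (card {S \<in> Q1. card S = s}) \<le> real (n ^ s)" by (simp only: of_nat_le_iff)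
        then have c: "real (card {S \<in> Q1. card S = s}) \<le> real n powr real s" using n by (simp add: powr_realpow)
        have "2 \<le> s" using True unfolding M_def by simp
        then have "real (card {S \<in> Q1. card S = s}) * g s
          \<le> real n powr real s * (2 ^ (2 ^ s) * real n powr (- (real s - 2) - \<epsilon> * l * (real s - 2) - \<epsilon>))"
          using c g g0 by (intro mult_mono) auto
        also have "\<dots> = 2 ^ (2 ^ s) * real n powr (real s + (- (real s - 2) - \<epsilon> * l * (real s - 2) - \<epsilon>))"
          by (simp only: powr_add mult_ac)
        also have "\<dots> \<le> 2 ^ (2 ^ s) * real n powr - 1"
          using large[OF True] \<epsilon> n1 by (intro mult_left_mono powr_mono) auto
        finally show ?thesis .
      next
        case False
        then have empty: "{S \<in> Q1. card S = s} = {}" unfolding Q1_def by auto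
        show ?thesis unfolding empty by simp
      qed
    qed (use fin in \<open>auto simp: Q1_def\<close>)
    \<comment> \<open>Small sets lack this gain, but they contain 0 and 1: only s - 2 vertices are
      free, and n^-\<epsilon> remains.\<close>
    have s2: "(\<Sum>S\<in>Q2. g (card S)) \<le> (\<Sum>s\<in>{2..M}. 2 ^ (2 ^ s) * real n powr - \<epsilon>)"
    proof (rule sum_by_card)
      fix s assume s: "s \<in> {2..M}"
      have "card {S \<in> Q2. card S = s} \<le> card {S. S \<subseteq> {0..<n} \<and> card S = s - 2}"
      proof (rule card_inj_on_le)
        show "inj_on (\<lambda>S. S - {0, 1}) {S \<in> Q2. card S = s}"
          by (rule inj_on_inverseI[where g = "\<lambda>S. S \<union> {0, 1}"]) (auto simp: Q2_def)
        show "(\<lambda>S. S - {0, 1}) ` {S \<in> Q2. card S = s} \<subseteq> {S. S \<subseteq> {0..<n} \<and> card S = s - 2}"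
          unfolding Q2_def by (auto simp: card_Diff_subset)
        show "finite {S. S \<subseteq> {0..<n} \<and> card S = s - 2}"
          by (rule finite_subset[of _ "Pow {0..<n}"]) auto
      qed
      also have "\<dots> \<le> n ^ (s - 2)" using card_subsets_le[of "{0..<n}" "s - 2"] by simp
      finally have "real (card {S \<in> Q2. card S = s}) \<le> real (n ^ (s - 2))" by (simp only: of_nat_le_iff)
      also have "\<dots> = real n powr (real s - 2)" using n s by (simp add: powr_realpow[symmetric] of_nat_diff)
      finally have c: "real (card {S \<in> Q2. card S = s}) \<le> real n powr (real s - 2)" .
      have "real (card {S \<in> Q2. card S = s}) * g s
        \<le> real n powr (real s - 2) * (2 ^ (2 ^ s) * real n powr (- (real s - 2) - \<epsilon> * l * (real s - 2) - \<epsilon>))"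
        using c g[of s] g0 s by (intro mult_mono) auto
      also have "\<dots> = 2 ^ (2 ^ s) * real n powr ((real s - 2) + (- (real s - 2) - \<epsilon> * l * (real s - 2) - \<epsilon>))"
        by (simp only: powr_add mult_ac)
      also have "\<dots> \<le> 2 ^ (2 ^ s) * real n powr - \<epsilon>"
      proof (intro mult_left_mono powr_mono)
        have "0 \<le> \<epsilon> * l * (real s - 2)" using \<epsilon> l s by simp
        then show "(real s - 2) + (- (real s - 2) - \<epsilon> * l * (real s - 2) - \<epsilon>) \<le> - \<epsilon>" by linarith
      qed (use n1 in auto)
      finally show "real (card {S \<in> Q2. card S = s}) * g s \<le> 2 ^ (2 ^ s) * real n powr - \<epsilon>" .
    next
      fix S assume "S \<in> Q2"
      then have S: "{0, 1} \<subseteq> S" "finite S" "card S \<le> M"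
        unfolding Q2_def by (auto intro: finite_subset)
      then have "card {0, 1::nat} \<le> card S" by (intro card_mono) auto
      then show "card S \<in> {2..M}" using S by simp
    qed (use fin in auto)
    have "gnp_prob n p (\<lambda>G. perc_closure n k EH G = all_edges n)
        \<le> bernoulli_exp p (all_edges n) (\<lambda>G. (\<Sum>S\<in>Q1. of_bool (\<exists>E. dense_in G l S E))
            + (\<Sum>S\<in>Q2. of_bool (\<exists>E. dense_in G l S E)))"
      unfolding gnp_prob_eq
    proof (rule bernoulli_exp_mono)
      fix G assume G: "G \<subseteq> all_edges n"
      let ?d = "\<lambda>S. of_bool (\<exists>E. dense_in G l S E) :: real"
      have nn: "0 \<le> sum ?d Q1" "0 \<le> sum ?d Q2" by (auto intro!: sum_nonneg)
      show "of_bool (perc_closure n k EH G = all_edges n) \<le> sum ?d Q1 + sum ?d Q2"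
      proof (cases "perc_closure n k EH G = all_edges n")
        case True
        have "{0, 1} \<in> all_edges n" unfolding all_edges_def using n by force
        then have e: "{0, 1} \<in> perc_closure n k EH G" using True by simp
        have "\<exists>S\<in>Q1 \<union> Q2. \<exists>E. dense_in G l S E"
        proof (cases "\<exists>S\<in>Q1. \<exists>E. dense_in G l S E")
          case False
          have "\<exists>S E. S \<subseteq> {0..<n} \<and> {0, 1} \<subseteq> S \<and> card S \<le> M \<and> dense_in G l S E"
          proof (rule perc_closure_dense[OF bal l_def G _ _ e])
            show "2 \<le> M" unfolding M_def by simp
            show "\<not> dense_in G l S E" if "S \<subseteq> {0..<n}" "M < card S" "card S \<le> k + card EH * M" for S E
              using False that unfolding Q1_def M'_def by blast
          qed
          then show ?thesis unfolding Q2_def by blast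
        qed blast
        then obtain S where S: "S \<in> Q1 \<union> Q2" "?d S = 1" by auto
        then consider "S \<in> Q1" | "S \<in> Q2" by blast
        then have "1 \<le> sum ?d Q1 + sum ?d Q2"
        proof cases
          case 1
          then show ?thesis using member_le_sum[of S Q1 ?d] S(2) fin nn by auto
        next
          case 2
          then show ?thesis using member_le_sum[of S Q2 ?d] S(2) fin nn by auto
        qed
        then show ?thesis using True by simp
      qed (use nn in simp)
    qed (use p p1 in auto)
    also have "\<dots> = (\<Sum>S\<in>Q1. bernoulli_exp p (all_edges n) (\<lambda>G. of_bool (\<exists>E. dense_in G l S E)))
        + (\<Sum>S\<in>Q2. bernoulli_exp p (all_edges n) (\<lambda>G. of_bool (\<exists>E. dense_in G l S E)))"
      by (simp only: bernoulli_exp_add bernoulli_exp_sum)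
    also have "\<dots> \<le> (\<Sum>S\<in>Q1. g (card S)) + (\<Sum>S\<in>Q2. g (card S))"
      using Q_prob by (intro add_mono sum_mono) auto
    also have "\<dots> \<le> D * real n powr - 1 + D2 * real n powr - \<epsilon>"
      using s1 s2 unfolding D_def D2_def sum_distrib_right by (rule add_mono)
    finally show ?thesis .
  qed
  have "(\<lambda>n. real n powr - 1) \<longlonglongrightarrow> 0" by real_asymp
  moreover have "(\<lambda>n. real n powr - \<epsilon>) \<longlonglongrightarrow> 0" using \<epsilon> by real_asymp
  ultimately have "(\<lambda>n. D * real n powr - 1 + D2 * real n powr - \<epsilon>) \<longlonglongrightarrow> D * 0 + D2 * 0"
    by (intro tendsto_intros)
  then have "(\<lambda>n. D * real n powr - 1 + D2 * real n powr - \<epsilon>) \<longlonglongrightarrow> 0" by simp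
  then have "eventually (\<lambda>n. D * real n powr - 1 + D2 * real n powr - \<epsilon> < 1 / 2) sequentially"
    by (rule order_tendstoD) simp
  then show ?thesis
    using eventually_ge_at_top[of 2]
  proof eventually_elim
    case (elim n)
    then show ?case using main[OF elim(2)] unfolding l_def by (meson le_less_trans)
  qed
qed

section \<open>The threshold exponent of a balanced graph\<close>

lemma p_crit_exponent:
  assumes bal: "balanced_graph k EH"
  shows "(\<lambda>n. - ln (p_crit n k EH) / ln (real n)) \<longlonglongrightarrow> 1 / lambda_H k EH"
proof (rule tendstoI)
  fix d :: real assume d: "0 < d"
  define l where "l = lambda_H k EH"
  have l: "1 \<le> l" using bal unfolding balanced_graph_def l_def by auto
  \<comment> \<open>The first term gives accuracy \<open>d\<close>; the second keeps \<epsilon>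
    below 1/\<lambda>, so that the upper candidate for \<open>p\<close> is at most 1.\<close>
  define \<epsilon> where "\<epsilon> = min (d / 2) (1 / (2 * l))"
  have \<epsilon>: "0 < \<epsilon>" "\<epsilon> < d" "\<epsilon> < 1 / l"
    unfolding \<epsilon>_def using d l by (auto simp: min_def field_simps)
  show "\<forall>\<^sub>F n in sequentially. dist (- ln (p_crit n k EH) / ln (real n)) (1 / lambda_H k EH) < d"
    using gnp_percolates[OF bal \<epsilon>(1) \<epsilon>(3)[unfolded l_def]] gnp_not_percolates[OF bal \<epsilon>(1)]
      eventually_ge_at_top[of 2]
    unfolding l_def[symmetric]
  proof eventually_elim
    case (elim n)
    let ?A = "{p. 0 < p \<and> p \<le> 1 \<and> 1 / 2 \<le> gnp_prob n p (\<lambda>G. perc_closure n k EH G = all_edges n)}"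
    let ?lo = "real n powr (- \<epsilon> - 1 / l)" and ?hi = "real n powr (\<epsilon> - 1 / l)"
    have n: "1 < real n" using elim by simp
    have "?hi \<le> real n powr 0" using n \<epsilon> by (intro powr_mono) auto
    then have hi: "?hi \<in> ?A" using elim n by simp
    have lo: "?lo \<le> p" if "p \<in> ?A" for p
    proof (rule ccontr)
      assume "\<not> ?lo \<le> p"
      then have "gnp_prob n p (\<lambda>G. perc_closure n k EH G = all_edges n) < 1 / 2" using elim(2) that by auto
      then show False using that by simp
    qed
    have pc: "p_crit n k EH = Inf ?A" unfolding p_crit_def by simp
    have "?lo \<le> p_crit n k EH" unfolding pc using hi lo by (intro cInf_greatest) auto
    moreover have "p_crit n k EH \<le> ?hi" unfolding pc using hi lo by (intro cInf_lower bdd_belowI) auto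
    moreover have "0 < ?lo" using n by simp
    ultimately have "ln ?lo \<le> ln (p_crit n k EH)" "ln (p_crit n k EH) \<le> ln ?hi"
      by (metis ln_mono less_le_trans)+
    then have "(- \<epsilon> - 1 / l) * ln (real n) \<le> ln (p_crit n k EH)" "ln (p_crit n k EH) \<le> (\<epsilon> - 1 / l) * ln (real n)"
      unfolding ln_powr by auto
    moreover have "0 < ln (real n)" using n by simp
    ultimately have "- \<epsilon> - 1 / l \<le> ln (p_crit n k EH) / ln (real n)" "ln (p_crit n k EH) / ln (real n) \<le> \<epsilon> - 1 / l"
      by (simp_all add: pos_le_divide_eq pos_divide_le_eq)
    then show ?case using \<epsilon> by (auto simp: dist_real_def abs_less_iff)
  qed
qed

section \<open>Random graphs are balanced\<close>

definition deg :: "nat \<Rightarrow> nat set set \<Rightarrow> nat \<Rightarrow> nat" where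
  "deg k EH v = card {x \<in> {0..<k}. {v, x} \<in> EH}"

definition codeg :: "nat \<Rightarrow> nat set set \<Rightarrow> nat \<Rightarrow> nat \<Rightarrow> nat" where
  "codeg k EH u w = card {x \<in> {0..<k}. {u, x} \<in> EH \<and> {w, x} \<in> EH}"

lemma card_ordered_edges:
  assumes "finite S" "\<And>e. e \<in> EH \<Longrightarrow> card e = 2"
  shows "card {z \<in> S \<times> S. {fst z, snd z} \<in> EH} = 2 * card (edges_in EH S)"
proof -
  let ?O = "{z \<in> S \<times> S. {fst z, snd z} \<in> EH}"
  let ?g = "\<lambda>z. {fst z, snd z}"
  have fin: "finite ?O" "finite (edges_in EH S)"
    using assms(1) by (auto simp: edges_in_def intro: finite_subset[of _ "Pow S"])
  have "card ?O = (\<Sum>e\<in>edges_in EH S. card {z \<in> ?O. ?g z = e})"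
    using sum.group[OF fin, of ?g "\<lambda>_. 1::nat"] by (force simp: edges_in_def)
  also have "\<dots> = (\<Sum>e\<in>edges_in EH S. 2)"
  proof (rule sum.cong[OF refl])
    fix e assume e: "e \<in> edges_in EH S"
    then have "card e = 2" using assms(2) unfolding edges_in_def by blast
    then obtain a b where ab: "e = {a, b}" "a \<noteq> b" by (auto simp: card_2_iff)
    have "{z \<in> ?O. ?g z = e} = {(a, b), (b, a)}"
      using e ab unfolding edges_in_def by (auto simp: doubleton_eq_iff insert_commute)
    then show "card {z \<in> ?O. ?g z = e} = 2" using ab by simp
  qed
  finally show ?thesis by simp
qed

text \<open>Twice the number of edges not inside \<open>F\<close> is the degree sum over
  \<open>R\<close> plus the number of edges between \<open>R\<close> and \<open>F\<close>. Minimum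
  degree controls the first term, codegrees the second; the second contributes the saving that grows
  with |F|.\<close>

lemma edges_outside_bound:
  assumes EH: "EH \<subseteq> all_edges k" and F: "F \<subseteq> {0..<k}" and R: "R = {0..<k} - F" and k: "0 < k"
    and deg: "\<And>v. v < k \<Longrightarrow> \<delta> \<le> real (deg k EH v)"
    and codeg: "\<And>u w. u < k \<Longrightarrow> w < k \<Longrightarrow> u \<noteq> w \<Longrightarrow> \<gamma> * real k \<le> real (codeg k EH u w)"
  shows "real (card R) * (\<delta> + \<gamma> * real (card F)) \<le> 2 * (real (card EH) - real (card (edges_in EH F)))"
proof -
  let ?O = "\<lambda>A B. {z \<in> A \<times> B. {fst z, snd z} \<in> EH}"
  have e2: "card e = 2" "e \<subseteq> {0..<k}" if "e \<in> EH" for e using that EH unfolding all_edges_altdef by auto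
  have fin: "finite F" "finite R" using F R finite_subset by auto
  have EHk: "edges_in EH {0..<k} = EH" using e2(2) unfolding edges_in_def by blast
  have tot: "card (?O {0..<k} {0..<k}) = 2 * card EH"
    using card_ordered_edges[of "{0..<k}" EH] e2 EHk by simp
  have inF: "card (?O F F) = 2 * card (edges_in EH F)"
    using card_ordered_edges[of F EH] e2 fin by simp
  have split: "card (?O {0..<k} {0..<k}) = card (?O F F) + card (?O R {0..<k}) + card (?O F R)"
  proof -
    have "?O {0..<k} {0..<k} = (?O F F \<union> ?O R {0..<k}) \<union> ?O F R" using F R by blast
    moreover have "card ((?O F F \<union> ?O R {0..<k}) \<union> ?O F R) = card (?O F F \<union> ?O R {0..<k}) + card (?O F R)"
      using fin R by (intro card_Un_disjoint) auto
    moreover have "card (?O F F \<union> ?O R {0..<k}) = card (?O F F) + card (?O R {0..<k})"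
      using fin R by (intro card_Un_disjoint) auto
    ultimately show ?thesis by simp
  qed
  have "?O R {0..<k} = Sigma R (\<lambda>v. {x \<in> {0..<k}. {v, x} \<in> EH})" by auto
  then have "card (?O R {0..<k}) = (\<Sum>v\<in>R. deg k EH v)"
    using fin by (simp add: card_SigmaI deg_def)
  then have "real (card (?O R {0..<k})) = (\<Sum>v\<in>R. real (deg k EH v))" by simp
  moreover have "(\<Sum>v\<in>R. \<delta>) \<le> (\<Sum>v\<in>R. real (deg k EH v))"
    using deg R by (intro sum_mono) auto
  ultimately have degs: "real (card R) * \<delta> \<le> real (card (?O R {0..<k}))" by simp
  \<comment> \<open>A path $u, x, w$ from $R$ to $F$ contains a crossing edge, and a crossing edge extends
    to at most $k$ such paths; so many common neighbours force many crossing edges.\<close>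
  define P where "P = Sigma (R \<times> F) (\<lambda>z. {x \<in> {0..<k}. {fst z, x} \<in> EH \<and> {snd z, x} \<in> EH})"
  have "card P \<le> card (?O R F \<times> {0..<k})"
  proof (rule card_inj_on_le)
    \<comment> \<open>The leftover vertex is in \<open>R\<close> when the middle vertex is, and in
      \<open>F\<close> otherwise, so the case, and with it the path, can be recovered.\<close>
    let ?j = "\<lambda>((u, w), x). if x \<in> R then ((x, w), u) else ((u, x), w)"
    show "inj_on ?j P"
      unfolding P_def inj_on_def using R by (auto split: if_splits)
    show "?j ` P \<subseteq> ?O R F \<times> {0..<k}"
      unfolding P_def using R F by (auto simp: insert_commute split: if_splits)
    show "finite (?O R F \<times> {0..<k})" using fin by simp
  qed
  then have "card P \<le> card (?O R F) * k" by (simp only: card_cartesian_product card_atLeastLessThan diff_zero)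
  then have "real (card P) \<le> real (card (?O R F)) * real k"
    by (simp only: of_nat_mult[symmetric] of_nat_le_iff)
  moreover have "real (card R) * real (card F) * (\<gamma> * real k) \<le> real (card P)"
  proof -
    have "card P = (\<Sum>z\<in>R \<times> F. codeg k EH (fst z) (snd z))"
      unfolding P_def using fin by (simp add: card_SigmaI codeg_def)
    then have "real (card P) = (\<Sum>z\<in>R \<times> F. real (codeg k EH (fst z) (snd z)))" by simp
    also have "\<dots> \<ge> (\<Sum>z\<in>R \<times> F. \<gamma> * real k)"
    proof (rule sum_mono)
      fix z assume z: "z \<in> R \<times> F"
      have "fst z < k" "snd z < k" "fst z \<noteq> snd z" using z R F by auto
      then show "\<gamma> * real k \<le> real (codeg k EH (fst z) (snd z))" by (rule codeg)
    qed
    finally show ?thesis by (simp add: card_cartesian_product)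
  qed
  ultimately have "(real (card R) * real (card F) * \<gamma>) * real k \<le> real (card (?O R F)) * real k"
    by (simp add: mult_ac)
  then have cross: "real (card R) * real (card F) * \<gamma> \<le> real (card (?O R F))"
    using k by simp
  have "card (?O F R) = card (?O R F)"
    by (rule bij_betw_same_card[of "\<lambda>z. (snd z, fst z)"], rule bij_betwI[where g = "\<lambda>z. (snd z, fst z)"])
      (auto simp: insert_commute)
  then have "real (2 * card EH) = real (2 * card (edges_in EH F)) + real (card (?O R {0..<k})) + real (card (?O R F))"
    using split tot inF by (simp only: of_nat_add[symmetric])
  then show ?thesis using degs cross by (simp add: algebra_simps)
qed

lemma double_choose_two: "2 * (m choose 2) = m * (m - 1)"
  unfolding choose_two by (rule dvd_mult_div_cancel) (cases "even m"; simp)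

text \<open>Small \<open>F\<close> satisfy the bound even if complete, because s (s - 1) / 2 = (s +
  1) / 2 * (s - 2) + 1. For large \<open>F\<close>, each of the r removed vertices takes away at
  least \<lambda> + 1 edges. Removing \<lambda> each would leave \<lambda> (s - 2) + 2; the surplus
  r \<ge> 1 turns the 2 into 1.\<close>

lemma balanced_graphI:
  assumes EH: "EH \<subseteq> all_edges k" and k: "3 \<le> k" and l: "l = lambda_H k EH" "1 \<le> l"
    and deg: "\<And>v. v < k \<Longrightarrow> \<delta> \<le> real (deg k EH v)"
    and codeg: "\<And>u w. u < k \<Longrightarrow> w < k \<Longrightarrow> u \<noteq> w \<Longrightarrow> \<gamma> * real k \<le> real (codeg k EH u w)"
    and size: "\<And>s::real. s + 1 \<le> 2 * l \<or> 2 * l + 2 \<le> \<delta> + \<gamma> * s"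
  shows "balanced_graph k EH"
  unfolding balanced_graph_def l(1)[symmetric]
proof (intro conjI allI impI EH k l(2))
  fix F assume F: "F \<subset> {0..<k}" "2 \<le> card F"
  define s where "s = real (card F)"
  have finF: "finite F" using F finite_subset by blast
  have s2: "2 \<le> s" unfolding s_def using F by simp
  from size[of s] show "real (card (edges_in EH F)) \<le> l * (real (card F) - 2) + 1"
  proof
    assume small: "s + 1 \<le> 2 * l"
    have "card (edges_in EH F) \<le> card {B. B \<subseteq> F \<and> card B = 2}"
      using EH finF by (intro card_mono) (auto simp: edges_in_def all_edges_altdef intro: finite_subset[of _ "Pow F"])
    also have "\<dots> = card F choose 2" using finF by (rule n_subsets)
    finally have "real (card (edges_in EH F)) \<le> real (card F choose 2)" by simp
    also have "\<dots> = s * (s - 1) / 2"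
    proof -
      have "2 * (card F choose 2) = card F * (card F - 1)" by (rule double_choose_two)
      then have "2 * real (card F choose 2) = real (card F) * real (card F - 1)"
        by (metis of_nat_mult of_nat_numeral)
      then show ?thesis unfolding s_def using F by (simp add: of_nat_diff)
    qed
    also have "\<dots> = (s + 1) / 2 * (s - 2) + 1" by (simp add: field_simps)
    also have "\<dots> \<le> l * (s - 2) + 1" using small s2 by (intro add_right_mono mult_right_mono) auto
    finally show ?thesis unfolding s_def .
  next
    assume large: "2 * l + 2 \<le> \<delta> + \<gamma> * s"
    define r where "r = real (card ({0..<k} - F))"
    have r: "r = real k - s"
    proof -
      have "card F \<le> k" using card_mono[of "{0..<k}" F] F by auto
      then show ?thesis unfolding r_def s_def using F finF by (simp add: card_Diff_subset of_nat_diff)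
    qed
    have r1: "1 \<le> r"
    proof -
      have "card F < k" using psubset_card_mono[OF _ F(1)] by simp
      then show ?thesis unfolding r s_def by simp
    qed
    have "r * (2 * l + 2) \<le> r * (\<delta> + \<gamma> * s)" using large r1 by (intro mult_left_mono) auto
    also have "\<dots> \<le> 2 * (real (card EH) - real (card (edges_in EH F)))"
      unfolding r_def s_def using F k by (intro edges_outside_bound[OF EH _ refl _ deg codeg]) auto
    finally have "real (card (edges_in EH F)) \<le> real (card EH) - r * l - r" by (simp add: algebra_simps)
    also have "\<dots> \<le> real (card EH) - r * l - 1" using r1 by simp
    also have "\<dots> = l * (s - 2) + 1"
      using lambda_H_mult[OF k, of EH] unfolding l(1)[symmetric] r by (simp add: algebra_simps)
    finally show ?thesis unfolding s_def .
  qed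
qed

section \<open>Chernoff bounds for counts of disjoint blocks\<close>

text \<open>Disjoint blocks of size \<open>b\<close> are present independently with probability p^b,
  so the count is binomial and this is its generating function. Degrees and edge counts use b = 1,
  codegrees b = 2.\<close>

lemma bernoulli_exp_generating_function:
  assumes I: "finite I" and E: "finite E" and B: "\<And>i. i \<in> I \<Longrightarrow> B i \<subseteq> E" "disjoint_family_on B I"
    and b: "\<And>i. i \<in> I \<Longrightarrow> card (B i) = b"
  shows "bernoulli_exp p E (\<lambda>G. y ^ card {i \<in> I. B i \<subseteq> G}) = (1 + p ^ b * (y - 1)) ^ card I"
proof -
  have "bernoulli_exp p E (\<lambda>G. y ^ card {i \<in> I. B i \<subseteq> G})
      = bernoulli_exp p E (\<lambda>G. \<Prod>i\<in>I. (\<lambda>H. 1 + (y - 1) * of_bool (B i \<subseteq> H)) (G \<inter> B i))"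
  proof (rule bernoulli_exp_cong)
    fix G
    have "y ^ card {i \<in> I. B i \<subseteq> G} = (\<Prod>i\<in>{i \<in> I. B i \<subseteq> G}. y)" by simp
    also have "\<dots> = (\<Prod>i\<in>I. if B i \<subseteq> G then y else 1)" by (rule prod.inter_filter[OF I])
    finally show "y ^ card {i \<in> I. B i \<subseteq> G} = (\<Prod>i\<in>I. (\<lambda>H. 1 + (y - 1) * of_bool (B i \<subseteq> H)) (G \<inter> B i))"
      by (auto intro!: prod.cong)
  qed
  also have "\<dots> = (\<Prod>i\<in>I. bernoulli_exp p (B i) (\<lambda>H. 1 + (y - 1) * of_bool (B i \<subseteq> H)))"
    by (rule bernoulli_exp_prod[OF I E B])
  also have "\<dots> = (\<Prod>i\<in>I. 1 + p ^ b * (y - 1))"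
  proof (rule prod.cong[OF refl])
    fix i assume i: "i \<in> I"
    have fin: "finite (B i)" using B(1)[OF i] E by (rule finite_subset)
    show "bernoulli_exp p (B i) (\<lambda>H. 1 + (y - 1) * of_bool (B i \<subseteq> H)) = 1 + p ^ b * (y - 1)"
      unfolding bernoulli_exp_add bernoulli_exp_cmult bernoulli_exp_one[OF fin]
        bernoulli_exp_supset[OF fin subset_refl] b[OF i] by simp
  qed
  finally show ?thesis by simp
qed

text \<open>Exponential Markov inequality for both tails at once: the sign of \<open>t\<close>
  selects the tail, and \<open>expo\<close> is the exponent per block after 1 + x \<le> exp
  x.\<close>

lemma chernoff_markov:
  assumes I: "finite I" and E: "finite E" and B: "\<And>i. i \<in> I \<Longrightarrow> B i \<subseteq> E" "disjoint_family_on B I"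
    and b: "\<And>i. i \<in> I \<Longrightarrow> card (B i) = b" and p: "0 \<le> p" "p \<le> 1"
    and bad: "\<And>G. G \<subseteq> E \<Longrightarrow> bad G \<Longrightarrow> 0 \<le> t * (real (card {i \<in> I. B i \<subseteq> G}) - \<tau> * real (card I))"
    and expo: "p ^ b * (exp t - 1) - t * \<tau> \<le> - c"
  shows "bernoulli_exp p E (\<lambda>G. of_bool (bad G)) \<le> exp (- c * real (card I))"
proof -
  let ?X = "\<lambda>G. card {i \<in> I. B i \<subseteq> G}"
  let ?q = "p ^ b"
  have q: "0 \<le> ?q" "?q \<le> 1" using p by (auto intro: power_le_one)
  have "bernoulli_exp p E (\<lambda>G. of_bool (bad G))
      \<le> bernoulli_exp p E (\<lambda>G. exp (- t * \<tau> * real (card I)) * exp t ^ ?X G)"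
  proof (rule bernoulli_exp_mono[OF p])
    fix G assume G: "G \<subseteq> E"
    have "exp (- t * \<tau> * real (card I)) * exp t ^ ?X G = exp (t * (real (?X G) - \<tau> * real (card I)))"
      by (simp add: exp_of_nat_mult[symmetric] exp_add[symmetric] algebra_simps)
    moreover have "1 \<le> exp (t * (real (?X G) - \<tau> * real (card I)))" if "bad G"
      using bad[OF G that] by simp
    ultimately show "of_bool (bad G) \<le> exp (- t * \<tau> * real (card I)) * exp t ^ ?X G" by auto
  qed
  also have "\<dots> = exp (- t * \<tau> * real (card I)) * (1 + ?q * (exp t - 1)) ^ card I"
    using bernoulli_exp_generating_function[where y = "exp t", OF I E B b] by (simp only: bernoulli_exp_cmult)
  also have "\<dots> \<le> exp (- t * \<tau> * real (card I)) * exp (?q * (exp t - 1)) ^ card I"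
  proof (intro mult_left_mono power_mono)
    show "1 + ?q * (exp t - 1) \<le> exp (?q * (exp t - 1))" by (rule exp_ge_add_one_self)
    have "0 \<le> (1 - ?q) + ?q * exp t" using q by (intro add_nonneg_nonneg) auto
    then show "0 \<le> 1 + ?q * (exp t - 1)" by (simp add: algebra_simps)
  qed simp
  also have "\<dots> = exp ((?q * (exp t - 1) - t * \<tau>) * real (card I))"
    by (simp add: exp_of_nat_mult[symmetric] exp_add[symmetric] algebra_simps)
  also have "\<dots> \<le> exp (- c * real (card I))"
    using expo by (subst exp_le_cancel_iff) (intro mult_right_mono, auto)
  finally show ?thesis .
qed

lemma chernoff_lower:
  assumes I: "finite I" and E: "finite E" and B: "\<And>i. i \<in> I \<Longrightarrow> B i \<subseteq> E" "disjoint_family_on B I"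
    and b: "\<And>i. i \<in> I \<Longrightarrow> card (B i) = b" and p: "0 \<le> p" "p \<le> 1" and \<eta>: "0 < \<eta>"
  shows "bernoulli_exp p E (\<lambda>G. of_bool (real (card {i \<in> I. B i \<subseteq> G}) \<le> (p ^ b - \<eta>) * real (card I)))
    \<le> exp (- (\<eta>\<^sup>2 / 4) * real (card I))"
proof (rule chernoff_markov[OF I E B b p, where t = "- (\<eta> / 2)" and \<tau> = "p ^ b - \<eta>"])
  let ?q = "p ^ b"
  have q: "0 \<le> ?q" "?q \<le> 1" using p by (auto intro: power_le_one)
  \<comment> \<open>This minimises the exponent t^2 - t \<eta> reached below.\<close>
  define t where "t = \<eta> / 2"
  have t: "0 < t" unfolding t_def using \<eta> by simp
  \<comment> \<open>It follows from (1 - t + t^2) (1 + t) = 1 + t^3 \<ge> 1.\<close>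
  have "exp (- t) \<le> 1 - t + t\<^sup>2"
  proof -
    have "exp (- t) = 1 / exp t" by (simp add: exp_minus field_simps)
    also have "\<dots> \<le> 1 / (1 + t)" using t exp_ge_add_one_self[of t] by (intro divide_left_mono) auto
    also have "\<dots> \<le> 1 - t + t\<^sup>2"
    proof -
      have "1 \<le> (1 - t + t\<^sup>2) * (1 + t)" using t by (simp add: power2_eq_square algebra_simps)
      then show ?thesis using t by (simp add: pos_divide_le_eq)
    qed
    finally show ?thesis .
  qed
  then have "?q * (exp (- t) - 1) \<le> ?q * (t\<^sup>2 - t)" using q by (intro mult_left_mono) auto
  also have "\<dots> \<le> t\<^sup>2 - ?q * t"
    using q mult_right_mono[of ?q 1 "t\<^sup>2"] by (simp add: algebra_simps)
  finally have "?q * (exp (- t) - 1) - (- t) * (?q - \<eta>) \<le> t\<^sup>2 - t * \<eta>" by (simp add: algebra_simps)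
  also have "\<dots> = - (\<eta>\<^sup>2 / 4)" unfolding t_def by (simp add: power2_eq_square)
  finally show "?q * (exp (- (\<eta> / 2)) - 1) - - (\<eta> / 2) * (?q - \<eta>) \<le> - (\<eta>\<^sup>2 / 4)" unfolding t_def .
qed (use \<eta> in \<open>auto intro!: mult_nonneg_nonneg simp: mult_le_0_iff\<close>)

lemma chernoff_upper:
  assumes I: "finite I" and E: "finite E" and B: "\<And>i. i \<in> I \<Longrightarrow> B i \<subseteq> E" "disjoint_family_on B I"
    and b: "\<And>i. i \<in> I \<Longrightarrow> card (B i) = b" and p: "0 \<le> p" "p \<le> 1" and \<eta>: "0 < \<eta>" "\<eta> \<le> 2"
  shows "bernoulli_exp p E (\<lambda>G. of_bool ((p ^ b + \<eta>) * real (card I) \<le> real (card {i \<in> I. B i \<subseteq> G})))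
    \<le> exp (- (\<eta>\<^sup>2 / 4) * real (card I))"
proof (rule chernoff_markov[OF I E B b p, where t = "\<eta> / 2" and \<tau> = "p ^ b + \<eta>"])
  let ?q = "p ^ b"
  have q: "0 \<le> ?q" "?q \<le> 1" using p by (auto intro: power_le_one)
  define t where "t = \<eta> / 2"
  have t: "0 < t" "t \<le> 1" unfolding t_def using \<eta> by auto
  \<comment> \<open>The quadratic bound is applied on t \<le> 1, hence the assumption \<eta> \<le>
    2.\<close>
  have "exp t \<le> 1 + t + t\<^sup>2" using t by (intro exp_bound) auto
  then have "?q * (exp t - 1) \<le> ?q * (t + t\<^sup>2)" using q by (intro mult_left_mono) auto
  also have "\<dots> \<le> t\<^sup>2 + ?q * t"
    using q mult_right_mono[of ?q 1 "t\<^sup>2"] by (simp add: algebra_simps)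
  finally have "?q * (exp t - 1) - t * (?q + \<eta>) \<le> t\<^sup>2 - t * \<eta>" by (simp add: algebra_simps)
  also have "\<dots> = - (\<eta>\<^sup>2 / 4)" unfolding t_def by (simp add: power2_eq_square)
  finally show "?q * (exp (\<eta> / 2) - 1) - \<eta> / 2 * (?q + \<eta>) \<le> - (\<eta>\<^sup>2 / 4)" unfolding t_def .
qed (use \<eta> in \<open>auto intro!: mult_nonneg_nonneg\<close>)

lemma low_degree_prob:
  assumes v: "v < k" and \<alpha>: "0 \<le> \<alpha>" "\<alpha> \<le> 1" and \<eta>: "0 < \<eta>"
  shows "bernoulli_exp \<alpha> (all_edges k) (\<lambda>G. of_bool (real (deg k G v) < (\<alpha> - \<eta>) * (real k - 1)))
    \<le> exp (- (\<eta>\<^sup>2 / 4) * (real k - 1))"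
proof -
  let ?I = "{0..<k} - {v}"
  have cI: "real (card ?I) = real k - 1" using v by (simp add: of_nat_diff)
  have "bernoulli_exp \<alpha> (all_edges k) (\<lambda>G. of_bool (real (deg k G v) < (\<alpha> - \<eta>) * (real k - 1)))
      \<le> bernoulli_exp \<alpha> (all_edges k)
          (\<lambda>G. of_bool (real (card {x \<in> ?I. {{v, x}} \<subseteq> G}) \<le> (\<alpha> ^ 1 - \<eta>) * real (card ?I)))"
  proof (rule bernoulli_exp_mono[OF \<alpha>])
    fix G
    have "card {x \<in> ?I. {{v, x}} \<subseteq> G} \<le> deg k G v" unfolding deg_def by (intro card_mono) auto
    then show "of_bool (real (deg k G v) < (\<alpha> - \<eta>) * (real k - 1))
      \<le> (of_bool (real (card {x \<in> ?I. {{v, x}} \<subseteq> G}) \<le> (\<alpha> ^ 1 - \<eta>) * real (card ?I)) :: real)"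
      unfolding cI by auto
  qed
  also have "\<dots> \<le> exp (- (\<eta>\<^sup>2 / 4) * real (card ?I))"
  proof (rule chernoff_lower[OF _ _ _ _ _ \<alpha> \<eta>])
    show "{{v, x}} \<subseteq> all_edges k" if "x \<in> ?I" for x
      using that v unfolding all_edges_def by auto
    show "disjoint_family_on (\<lambda>x. {{v, x}}) ?I"
      unfolding disjoint_family_on_def by (auto simp: doubleton_eq_iff)
  qed auto
  finally show ?thesis unfolding cI .
qed

text \<open>For distinct \<open>x\<close> the two-edge paths from \<open>u\<close> via
  \<open>x\<close> to \<open>w\<close> share no edge, so they serve as blocks of size 2.\<close>

lemma low_codegree_prob:
  assumes uw: "u < k" "w < k" "u \<noteq> w" and \<alpha>: "0 \<le> \<alpha>" "\<alpha> \<le> 1" and \<eta>: "0 < \<eta>"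
  shows "bernoulli_exp \<alpha> (all_edges k) (\<lambda>G. of_bool (real (codeg k G u w) < (\<alpha>\<^sup>2 - \<eta>) * (real k - 2)))
    \<le> exp (- (\<eta>\<^sup>2 / 4) * (real k - 2))"
proof -
  let ?I = "{0..<k} - {u, w}"
  have cI: "real (card ?I) = real k - 2" using uw by (simp add: of_nat_diff card_Diff_subset)
  have "bernoulli_exp \<alpha> (all_edges k) (\<lambda>G. of_bool (real (codeg k G u w) < (\<alpha>\<^sup>2 - \<eta>) * (real k - 2)))
      \<le> bernoulli_exp \<alpha> (all_edges k)
          (\<lambda>G. of_bool (real (card {x \<in> ?I. {{u, x}, {w, x}} \<subseteq> G}) \<le> (\<alpha>\<^sup>2 - \<eta>) * real (card ?I)))"
  proof (rule bernoulli_exp_mono[OF \<alpha>])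
    fix G
    have "card {x \<in> ?I. {{u, x}, {w, x}} \<subseteq> G} \<le> codeg k G u w" unfolding codeg_def by (intro card_mono) auto
    then show "of_bool (real (codeg k G u w) < (\<alpha>\<^sup>2 - \<eta>) * (real k - 2))
      \<le> (of_bool (real (card {x \<in> ?I. {{u, x}, {w, x}} \<subseteq> G}) \<le> (\<alpha>\<^sup>2 - \<eta>) * real (card ?I)) :: real)"
      unfolding cI by auto
  qed
  also have "\<dots> \<le> exp (- (\<eta>\<^sup>2 / 4) * real (card ?I))"
  proof (rule chernoff_lower[OF _ _ _ _ _ \<alpha> \<eta>])
    show "{{u, x}, {w, x}} \<subseteq> all_edges k" if "x \<in> ?I" for x
      using that uw unfolding all_edges_def by auto
    show "disjoint_family_on (\<lambda>x. {{u, x}, {w, x}}) ?I"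
      unfolding disjoint_family_on_def by (auto simp: doubleton_eq_iff)
    show "card {{u, x}, {w, x}} = 2" for x
      using uw by (auto simp: card_2_iff doubleton_eq_iff)
  qed auto
  finally show ?thesis unfolding cI .
qed

lemma card_all_edges: "real (card (all_edges k)) = real k * (real k - 1) / 2"
proof -
  have "card (all_edges k) = k choose 2"
    unfolding all_edges_altdef using n_subsets[of "{0..<k}" 2] by simp
  moreover have "2 * (k choose 2) = k * (k - 1)" by (rule double_choose_two)
  ultimately have "real (2 * card (all_edges k)) = real (k * (k - 1))" by simp
  then show ?thesis by (cases k) (auto simp: algebra_simps)
qed

lemma many_edges_prob:
  assumes \<alpha>: "0 \<le> \<alpha>" "\<alpha> \<le> 1" and \<eta>: "0 < \<eta>" "\<eta> \<le> 2"
  shows "bernoulli_exp \<alpha> (all_edges k) (\<lambda>G. of_bool ((\<alpha> + \<eta>) * (real k * (real k - 1) / 2) < real (card G)))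
    \<le> exp (- (\<eta>\<^sup>2 / 4) * (real k * (real k - 1) / 2))"
proof -
  have "bernoulli_exp \<alpha> (all_edges k) (\<lambda>G. of_bool ((\<alpha> + \<eta>) * (real k * (real k - 1) / 2) < real (card G)))
      \<le> bernoulli_exp \<alpha> (all_edges k) (\<lambda>G. of_bool ((\<alpha> ^ 1 + \<eta>) * real (card (all_edges k))
          \<le> real (card {e \<in> all_edges k. {e} \<subseteq> G})))"
  proof (rule bernoulli_exp_mono[OF \<alpha>])
    fix G assume "G \<subseteq> all_edges k"
    then have "{e \<in> all_edges k. {e} \<subseteq> G} = G" by auto
    then show "of_bool ((\<alpha> + \<eta>) * (real k * (real k - 1) / 2) < real (card G))
      \<le> (of_bool ((\<alpha> ^ 1 + \<eta>) * real (card (all_edges k)) \<le> real (card {e \<in> all_edges k. {e} \<subseteq> G})) :: real)"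
      unfolding card_all_edges by auto
  qed
  also have "\<dots> \<le> exp (- (\<eta>\<^sup>2 / 4) * real (card (all_edges k)))"
    by (rule chernoff_upper[OF _ _ _ _ _ \<alpha> \<eta>]) (auto simp: disjoint_family_on_def)
  finally show ?thesis unfolding card_all_edges .
qed

text \<open>Both 2 \<lambda> and the minimum degree are \<alpha> k up to \<eta> k and constants, so
  2 \<lambda> + 2 - \<delta> \<le> 2 \<eta> k + 7. A set too large for the trivial regime has at
  least \<alpha> k / 2 vertices, and its codegrees contribute \<alpha>^3 k / 8. The choice of \<eta>
  makes this 4 \<eta> k, and \<eta> k \<ge> 4 absorbs the 7.\<close>

lemma balanced_graph_of_degrees:
  assumes \<alpha>: "0 < \<alpha>" "\<alpha> \<le> 1" and \<eta>: "\<eta> = \<alpha> ^ 3 / 32" and k: "4 / \<eta> \<le> real k"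
    and EH: "EH \<subseteq> all_edges k"
    and deg: "\<And>v. v < k \<Longrightarrow> (\<alpha> - \<eta>) * (real k - 1) \<le> real (deg k EH v)"
    and codeg: "\<And>u w. u < k \<Longrightarrow> w < k \<Longrightarrow> u \<noteq> w \<Longrightarrow> (\<alpha>\<^sup>2 - \<alpha>\<^sup>2 / 2) * (real k - 2) \<le> real (codeg k EH u w)"
    and edges: "real (card EH) \<le> (\<alpha> + \<eta>) * (real k * (real k - 1) / 2)"
  shows "balanced_graph k EH"
proof -
  define \<delta> where "\<delta> = (\<alpha> - \<eta>) * (real k - 1)"
  define l where "l = lambda_H k EH"
  have \<alpha>3: "\<alpha> ^ 3 \<le> \<alpha>" using \<alpha> power_decreasing[of 1 3 \<alpha>] by simp
  have \<eta>0: "0 < \<eta>" "\<eta> \<le> \<alpha> / 32" using \<alpha> \<alpha>3 unfolding \<eta> by auto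
  have k\<eta>: "4 \<le> \<eta> * real k" using k \<eta>0 by (simp add: pos_divide_le_eq mult.commute)
  have k\<alpha>: "128 \<le> \<alpha> * real k"
    using k\<eta> mult_right_mono[OF \<eta>0(2), of "real k"] by simp
  then have k128: "128 \<le> real k" using \<alpha> mult_right_mono[of \<alpha> 1 "real k"] by simp
  then have k3: "3 \<le> k" by simp
  have \<delta>_lo: "\<alpha> * real k - \<eta> * real k - 1 \<le> \<delta>"
    unfolding \<delta>_def using \<alpha> \<eta>0 by (simp add: algebra_simps)
  have "\<eta> * real k \<le> \<alpha> * real k / 32" using mult_right_mono[OF \<eta>0(2), of "real k"] by simp
  then have \<delta>2: "\<alpha> * real k / 2 + 2 \<le> \<delta> - 1" using \<delta>_lo k\<alpha> by linarith
  have l_mult: "l * (real k - 2) = real (card EH) - 2" unfolding l_def by (rule lambda_H_mult[OF k3])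
  \<comment> \<open>The outside bound with \<open>F\<close> empty is the handshake inequality k
    \<delta> \<le> 2 e_H; \<delta> \<ge> 2 covers the two edges subtracted in \<lambda>.\<close>
  have two_l: "\<delta> \<le> 2 * l"
  proof -
    have "edges_in EH {} = {}" using EH unfolding edges_in_def all_edges_altdef by auto
    then have "real k * \<delta> \<le> 2 * real (card EH)"
      using edges_outside_bound[OF EH, of "{}" "{0..<k}" \<delta> 0] deg k3 unfolding \<delta>_def by simp
    moreover have "2 * \<delta> \<ge> 4" using \<delta>2 k\<alpha> by linarith
    ultimately have "\<delta> * (real k - 2) \<le> 2 * l * (real k - 2)" using l_mult by (simp add: algebra_simps)
    then show ?thesis using k128 by simp
  qed
  have l_up: "2 * l \<le> (\<alpha> + \<eta>) * real k + 4"
  proof -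
    have "2 * l * (real k - 2) \<le> (\<alpha> + \<eta>) * (real k * (real k - 1))" using l_mult edges by (simp add: algebra_simps)
    also have "\<dots> = (\<alpha> + \<eta>) * real k * (real k - 2) + (\<alpha> + \<eta>) * real k" by (simp add: algebra_simps)
    also have "\<dots> \<le> (\<alpha> + \<eta>) * real k * (real k - 2) + 4 * (real k - 2)"
    proof -
      have "(\<alpha> + \<eta>) * real k \<le> 2 * real k" using \<alpha> \<eta>0 by (intro mult_right_mono) auto
      also have "\<dots> \<le> 4 * (real k - 2)" using k128 by simp
      finally show ?thesis by (rule add_left_mono)
    qed
    finally have "2 * l * (real k - 2) \<le> ((\<alpha> + \<eta>) * real k + 4) * (real k - 2)" by (simp add: algebra_simps)
    then show ?thesis using k128 by simp
  qed
  show ?thesis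
  proof (rule balanced_graphI[OF EH k3 l_def])
    show "1 \<le> l" using two_l \<delta>2 k\<alpha> by linarith
    show "\<delta> \<le> real (deg k EH v)" if "v < k" for v using deg[OF that] unfolding \<delta>_def .
    show "\<alpha>\<^sup>2 / 4 * real k \<le> real (codeg k EH u w)" if "u < k" "w < k" "u \<noteq> w" for u w
    proof -
      have "\<alpha>\<^sup>2 / 4 * real k \<le> \<alpha>\<^sup>2 / 4 * (2 * (real k - 2))" using k128 by (intro mult_left_mono) auto
      also have "\<dots> = (\<alpha>\<^sup>2 - \<alpha>\<^sup>2 / 2) * (real k - 2)" by (simp add: field_simps)
      finally show ?thesis using codeg[OF that] by linarith
    qed
    show "s + 1 \<le> 2 * l \<or> 2 * l + 2 \<le> \<delta> + \<alpha>\<^sup>2 / 4 * s" for s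
    proof (rule disjCI)
      assume "\<not> 2 * l + 2 \<le> \<delta> + \<alpha>\<^sup>2 / 4 * s"
      show "s + 1 \<le> 2 * l"
      proof (rule ccontr)
        assume "\<not> s + 1 \<le> 2 * l"
        then have "\<alpha> * real k / 2 \<le> s" using two_l \<delta>2 by linarith
        then have "\<alpha>\<^sup>2 / 4 * (\<alpha> * real k / 2) \<le> \<alpha>\<^sup>2 / 4 * s" by (intro mult_left_mono) auto
        moreover have "\<alpha>\<^sup>2 / 4 * (\<alpha> * real k / 2) = 4 * (\<eta> * real k)"
          unfolding \<eta> by (simp add: power2_eq_square power3_eq_cube)
        ultimately have "4 * (\<eta> * real k) \<le> \<alpha>\<^sup>2 / 4 * s" by (simp only:)
        then have "2 * l + 2 \<le> \<delta> + \<alpha>\<^sup>2 / 4 * s"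
          using l_up \<delta>_lo k\<eta> by (simp add: algebra_simps)
        then show False using \<open>\<not> 2 * l + 2 \<le> \<delta> + \<alpha>\<^sup>2 / 4 * s\<close> by simp
      qed
    qed
  qed
qed

text \<open>Union bound over k vertices, at most k^2 pairs and one edge count. Every rate is at
  least linear in k, so the exponentials beat these factors.\<close>

lemma gnp_balanced:
  assumes \<alpha>: "0 < \<alpha>" "\<alpha> \<le> 1"
  shows "(\<lambda>k. gnp_prob k \<alpha> (balanced_graph k)) \<longlonglongrightarrow> 1"
proof -
  define \<eta> where "\<eta> = \<alpha> ^ 3 / 32"
  have \<eta>: "0 < \<eta>" "\<eta> \<le> 2"
    unfolding \<eta>_def using \<alpha> power_le_one[of \<alpha> 3] by auto
  have \<alpha>2: "0 < \<alpha>\<^sup>2 / 2" using \<alpha> by simp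
  define c1 where "c1 = \<eta>\<^sup>2 / 4"
  define c2 where "c2 = (\<alpha>\<^sup>2 / 2)\<^sup>2 / 4"
  have c: "0 < c1" "0 < c2" unfolding c1_def c2_def using \<eta> \<alpha>2 by auto
  define err where "err k = real k * exp (- c1 * (real k - 1)) + real k ^ 2 * exp (- c2 * (real k - 2))
    + exp (- c1 * (real k * (real k - 1) / 2))" for k :: nat
  have bound: "1 - err k \<le> gnp_prob k \<alpha> (balanced_graph k)" if k: "4 / \<eta> \<le> real k" for k
  proof -
    let ?E = "all_edges k"
    let ?W = "{z \<in> {0..<k} \<times> {0..<k}. fst z \<noteq> snd z}"
    let ?A = "\<lambda>v G. of_bool (real (deg k G v) < (\<alpha> - \<eta>) * (real k - 1)) :: real"
    let ?B = "\<lambda>z G. of_bool (real (codeg k G (fst z) (snd z)) < (\<alpha>\<^sup>2 - \<alpha>\<^sup>2 / 2) * (real k - 2)) :: real"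
    let ?D = "\<lambda>G. of_bool ((\<alpha> + \<eta>) * (real k * (real k - 1) / 2) < real (card G)) :: real"
    have a01: "0 \<le> \<alpha>" using \<alpha> by simp
    have "1 = bernoulli_exp \<alpha> ?E (\<lambda>_. 1)" by (simp add: bernoulli_exp_one)
    also have "\<dots> \<le> bernoulli_exp \<alpha> ?E (\<lambda>G. of_bool (balanced_graph k G)
        + ((\<Sum>v\<in>{0..<k}. ?A v G) + ((\<Sum>z\<in>?W. ?B z G) + ?D G)))"
    proof (rule bernoulli_exp_mono[OF a01 \<alpha>(2)])
      fix G assume G: "G \<subseteq> ?E"
      have nn: "0 \<le> (\<Sum>v\<in>{0..<k}. ?A v G)" "0 \<le> (\<Sum>z\<in>?W. ?B z G)" "0 \<le> ?D G"
        by (intro sum_nonneg; simp)+ simp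
      show "1 \<le> of_bool (balanced_graph k G) + ((\<Sum>v\<in>{0..<k}. ?A v G) + ((\<Sum>z\<in>?W. ?B z G) + ?D G))"
      proof (cases "balanced_graph k G")
        case False
        have "(\<exists>v\<in>{0..<k}. ?A v G = 1) \<or> (\<exists>z\<in>?W. ?B z G = 1) \<or> ?D G = 1"
        proof (rule ccontr)
          assume "\<not> ?thesis"
          then have good: "\<forall>v\<in>{0..<k}. ?A v G \<noteq> 1" "\<forall>z\<in>?W. ?B z G \<noteq> 1" "?D G \<noteq> 1" by blast+
          have "balanced_graph k G"
          proof (rule balanced_graph_of_degrees[OF \<alpha> \<eta>_def k G])
            show "(\<alpha> - \<eta>) * (real k - 1) \<le> real (deg k G v)" if "v < k" for v
              using bspec[OF good(1), of v] that by (simp add: not_less)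
            show "(\<alpha>\<^sup>2 - \<alpha>\<^sup>2 / 2) * (real k - 2) \<le> real (codeg k G u w)" if "u < k" "w < k" "u \<noteq> w" for u w
              using bspec[OF good(2), of "(u, w)"] that by (simp add: not_less)
            show "real (card G) \<le> (\<alpha> + \<eta>) * (real k * (real k - 1) / 2)"
              using good(3) by (simp add: not_less)
          qed
          then show False using False by simp
        qed
        then consider v where "v \<in> {0..<k}" "?A v G = 1" | z where "z \<in> ?W" "?B z G = 1" | "?D G = 1"
          by blast
        then have "1 \<le> (\<Sum>v\<in>{0..<k}. ?A v G) + ((\<Sum>z\<in>?W. ?B z G) + ?D G)"
        proof cases
          case 1
          have "?A v G \<le> (\<Sum>v\<in>{0..<k}. ?A v G)" using 1(1) by (intro member_le_sum) auto
          then show ?thesis using 1(2) nn by linarith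
        next
          case 2
          have "?B z G \<le> (\<Sum>z\<in>?W. ?B z G)" using 2(1) by (intro member_le_sum) auto
          then show ?thesis using 2(2) nn by linarith
        next
          case 3
          then show ?thesis using nn by linarith
        qed
        then show ?thesis using False by simp
      qed (use nn in simp)
    qed
    also have "\<dots> = gnp_prob k \<alpha> (balanced_graph k) + ((\<Sum>v\<in>{0..<k}. bernoulli_exp \<alpha> ?E (?A v))
        + ((\<Sum>z\<in>?W. bernoulli_exp \<alpha> ?E (?B z)) + bernoulli_exp \<alpha> ?E ?D))"
      by (simp only: bernoulli_exp_add bernoulli_exp_sum gnp_prob_eq)
    finally have total: "1 \<le> gnp_prob k \<alpha> (balanced_graph k) + ((\<Sum>v\<in>{0..<k}. bernoulli_exp \<alpha> ?E (?A v))
        + ((\<Sum>z\<in>?W. bernoulli_exp \<alpha> ?E (?B z)) + bernoulli_exp \<alpha> ?E ?D))" .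
    have "(\<Sum>v\<in>{0..<k}. bernoulli_exp \<alpha> ?E (?A v)) \<le> (\<Sum>v\<in>{0..<k}. exp (- c1 * (real k - 1)))"
      unfolding c1_def using low_degree_prob[OF _ a01 \<alpha>(2) \<eta>(1)] by (intro sum_mono) auto
    then have A: "(\<Sum>v\<in>{0..<k}. bernoulli_exp \<alpha> ?E (?A v)) \<le> real k * exp (- c1 * (real k - 1))" by simp
    have "(\<Sum>z\<in>?W. bernoulli_exp \<alpha> ?E (?B z)) \<le> (\<Sum>z\<in>?W. exp (- c2 * (real k - 2)))"
      unfolding c2_def using low_codegree_prob[OF _ _ _ a01 \<alpha>(2) \<alpha>2] by (intro sum_mono) auto
    also have "\<dots> = real (card ?W) * exp (- c2 * (real k - 2))" by simp
    also have "\<dots> \<le> real k ^ 2 * exp (- c2 * (real k - 2))"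
    proof (rule mult_right_mono)
      have "card ?W \<le> card ({0..<k} \<times> {0..<k})" by (intro card_mono) auto
      then have "card ?W \<le> k ^ 2" by (simp add: power2_eq_square)
      then have "real (card ?W) \<le> real (k ^ 2)" by (simp only: of_nat_le_iff)
      then show "real (card ?W) \<le> real k ^ 2" by simp
    qed simp
    finally have B: "(\<Sum>z\<in>?W. bernoulli_exp \<alpha> ?E (?B z)) \<le> real k ^ 2 * exp (- c2 * (real k - 2))" .
    have D: "bernoulli_exp \<alpha> ?E ?D \<le> exp (- c1 * (real k * (real k - 1) / 2))"
      unfolding c1_def by (rule many_edges_prob[OF a01 \<alpha>(2) \<eta>])
    show ?thesis using total A B D unfolding err_def by linarith
  qed
  have "(\<lambda>k. real k * exp (- c1 * (real k - 1))) \<longlonglongrightarrow> 0" using c by real_asymp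
  moreover have "(\<lambda>k. real k ^ 2 * exp (- c2 * (real k - 2))) \<longlonglongrightarrow> 0" using c by real_asymp
  moreover have "(\<lambda>k. exp (- c1 * (real k * (real k - 1) / 2))) \<longlonglongrightarrow> 0" using c by real_asymp
  ultimately have "err \<longlonglongrightarrow> 0 + 0 + 0" unfolding err_def by (intro tendsto_add)
  then have lim: "(\<lambda>k. 1 - err k) \<longlonglongrightarrow> 1"
    using tendsto_diff[of "\<lambda>_. 1" 1 sequentially err 0] by simp
  show ?thesis
  proof (rule tendsto_sandwich[OF _ _ lim tendsto_const])
    obtain N :: nat where "4 / \<eta> < real N" using reals_Archimedean2 by blast
    then show "\<forall>\<^sub>F k in sequentially. 1 - err k \<le> gnp_prob k \<alpha> (balanced_graph k)"
      using eventually_ge_at_top[of N] by (elim eventually_mono) (rule bound, linarith)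
  qed (use \<alpha> in \<open>simp add: gnp_prob_le_1\<close>)
qed

lemma gnp_prob_tendsto_1_mono:
  assumes "(\<lambda>k. gnp_prob k \<alpha> (P k)) \<longlonglongrightarrow> 1" "0 < \<alpha>" "\<alpha> \<le> 1" "\<And>k G. P k G \<Longrightarrow> Q k G"
  shows "(\<lambda>k. gnp_prob k \<alpha> (Q k)) \<longlonglongrightarrow> 1"
proof (rule tendsto_sandwich[OF _ _ assms(1) tendsto_const])
  have "gnp_prob k \<alpha> (P k) \<le> gnp_prob k \<alpha> (Q k)" for k
    unfolding gnp_prob_eq using assms by (intro bernoulli_exp_mono) auto
  then show "\<forall>\<^sub>F k in sequentially. gnp_prob k \<alpha> (P k) \<le> gnp_prob k \<alpha> (Q k)" by simp
  show "\<forall>\<^sub>F k in sequentially. gnp_prob k \<alpha> (Q k) \<le> 1" using assms by (simp add: gnp_prob_le_1)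
qed

text \<open>The threshold limit is a deterministic consequence of balancedness for each fixed graph,
  so only the probability of balancedness has to tend to 1.\<close>

lemmas gnp_p_crit_exponent = gnp_prob_tendsto_1_mono[OF gnp_balanced _ _ p_crit_exponent]

theorem theorem1:
  fixes \<alpha> :: real
  assumes "0 < \<alpha>" and "\<alpha> \<le> 1"
  shows "(\<lambda>k. gnp_prob k \<alpha> (\<lambda>EH. \<exists>L.
            ((\<lambda>n. - ln (p_crit n k EH) / ln (real n)) \<longlonglongrightarrow> L) \<and>
            L = 1 / lambda_H k EH)) \<longlonglongrightarrow> 1"
  using gnp_p_crit_exponent[OF assms assms] by simp

end
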